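(* Let $K$ be a field. An inverse semigroup $S$ has enough finite dimensional irreducible representations over $K$ to separate points if and only if: (1) the characters of $E(S)$ of finite index in $S$ separate points of $E(S)$; and (2) for each $e\in E(S)$ and each $s\in S$ with $s\neq e$ and $s^*s=e=ss^*$, there is a character $\varphi$ of finite index in $S$ such that $\varphi(e)=1$ and either: (a) $s\varphi\neq\varphi$; or (b) $s\varphi=\varphi$ and there is a finite dimensional irreducible representation $\psi$ of $G_\varphi$ over $K$ such that $\psi([s,\varphi])\neq1$.
   Context: An inverse semigroup is a semigroup $S$ such that each $s\in S$ has a unique $s^*$ with $ss^*s=s$, $s^*ss^*=s^*$. $E(S)$ is its commutative semigroup of idempotents; $s\le t$ iff $s=et$ for some $e\in E(S)$. Representations of $S$ over $K$ are representations of the semigroup algebra $KS$, assumed non-degenerate: the corresponding module $V$ satisfies $KS\cdot V=V$. "Enough finite dimensional irreducible representations to separate points" means that for all $s\neq t$ in $S$ there is a finite dimensional irreducible representation $\rho$ of $S$ over $K$ with $\rho(s)\neq\rho(t)$. A character is a non-zero semilattice homomorphism $\varphi\colon E(S)\to\{0,1\}$; $\widehat{E(S)}$ is the set of characters. If $\varphi(s^*s)=1$, then $s\varphi$ is the character $(s\varphi)(e)=\varphi(s^*es)$; this defines the spectral action of $S$ by partial bijections on $\widehat{E(S)}$. $\varphi$ has finite index in $S$ if its orbit $\{s\varphi\mid s\in S,\ \varphi(s^*s)=1\}$ is finite. $S_\varphi=\{s\in S\mid\varphi(s^*s)=1,\ s\varphi=\varphi\}$ is an inverse subsemigroup, and $G_\varphi$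 is its maximal group image, i.e. the group $S_\varphi/{\sim}$ where $s\sim t$ iff $s,t$ have a common lower bound in $S_\varphi$; $[s,\varphi]$ denotes the class of $s\in S_\varphi$ in $G_\varphi$. Characters of finite index separate points of $E(S)$ if for all $e\neq f$ in $E(S)$ there is a finite index character $\varphi$ with $\varphi(e)\neq\varphi(f)$. *)

theory Defs
  imports "Jordan_Normal_Form.VS_Connect" "HOL-Library.FuncSet"
begin

section \<open>Inverse semigroups\<close>

class inverse_semigroup = semigroup_mult +
  assumes ex1_star: "\<exists>!t. s * t * s = s \<and> t * s * t = t"

definition star :: "'a::inverse_semigroup \<Rightarrow> 'a"  (\<open>_\<^sup>\<star>\<close> [1000] 999) where
  "s\<^sup>\<star> = (THE t. s * t * s = s \<and> t * s * t = t)"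

definition idems :: "'a::inverse_semigroup set" where
  "idems = {e. e * e = e}"

definition nat_le :: "'a::inverse_semigroup \<Rightarrow> 'a \<Rightarrow> bool"  (infix \<open>\<preceq>\<close> 50) where
  "s \<preceq> t \<longleftrightarrow> (\<exists>e\<in>idems. s = e * t)"


section \<open>Characters and the spectral action\<close>

text \<open>Characters are functions on \<open>E(S)\<close>, encoded as extensional functions, so that
  equality of functions on the whole type is equality of characters. The semilattice
  \<open>{0,1}\<close> is the set of natural numbers 0 and 1 with its meet (equivalently, multiplication).\<close>

definition characters :: "('a::inverse_semigroup \<Rightarrow> nat) set" where
  "characters = {\<phi> \<in> idems \<rightarrow>\<^sub>E {0, 1}.
     (\<forall>e\<in>idems. \<forall>f\<in>idems. \<phi> (e * f) = min (\<phi> e) (\<phi> f)) \<and> (\<exists>e\<in>idems. \<phi> e \<noteq> 0)}"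

text \<open>The formula is applied to all \<open>s\<close>; it is the spectral action only where
  \<open>\<phi> (s\<^sup>\<star> * s) = 1\<close>, and every use below carries this side condition.\<close>

definition act :: "'a::inverse_semigroup \<Rightarrow> ('a \<Rightarrow> nat) \<Rightarrow> 'a \<Rightarrow> nat" where
  "act s \<phi> = (\<lambda>e\<in>idems. \<phi> (s\<^sup>\<star> * e * s))"

definition finite_index :: "('a::inverse_semigroup \<Rightarrow> nat) \<Rightarrow> bool" where
  "finite_index \<phi> \<longleftrightarrow> finite {act s \<phi> | s. \<phi> (s\<^sup>\<star> * s) = 1}"

definition stab :: "('a::inverse_semigroup \<Rightarrow> nat) \<Rightarrow> 'a set" where
  "stab \<phi> = {s. \<phi> (s\<^sup>\<star> * s) = 1 \<and> act s \<phi> = \<phi>}"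

definition germ_rel :: "('a::inverse_semigroup \<Rightarrow> nat) \<Rightarrow> ('a \<times> 'a) set" where
  "germ_rel \<phi> = {(s, t). s \<in> stab \<phi> \<and> t \<in> stab \<phi> \<and> (\<exists>u\<in>stab \<phi>. u \<preceq> s \<and> u \<preceq> t)}"

definition germ :: "'a::inverse_semigroup \<Rightarrow> ('a \<Rightarrow> nat) \<Rightarrow> 'a set" where
  "germ s \<phi> = germ_rel \<phi> `` {s}"

text \<open>The maximal group image \<open>G\<^sub>\<phi> = S\<^sub>\<phi>/\<sim>\<close>. The product of two classes is written as a
  union over representatives (all of which give the same class); the identity is the class
  of the idempotents of \<open>S\<^sub>\<phi>\<close>.\<close>

definition isotropy_group :: "('a::inverse_semigroup \<Rightarrow> nat) \<Rightarrow> 'a set monoid" where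
  "isotropy_group \<phi> =
     \<lparr>carrier = stab \<phi> // germ_rel \<phi>,
      mult = (\<lambda>A B. \<Union>s\<in>A. \<Union>t\<in>B. germ (s * t) \<phi>),
      one = germ_rel \<phi> `` (idems \<inter> stab \<phi>)\<rparr>"


section \<open>Finite dimensional representations\<close>

text \<open>A representation of the semigroup with carrier \<open>A\<close> and multiplication \<open>m\<close> on \<open>V = K\<^sup>n\<close>.
  A representation of the semigroup algebra is determined by its restriction to the
  semigroup, and \<open>KA \<cdot> V\<close> is the span of the vectors \<open>\<rho> s v\<close>. The last conjunct is
  non-degeneracy, \<open>KA \<cdot> V = V\<close>. For a group this says that the identity acts as the
  identity matrix.\<close>

definition fd_rep ::
  "'s set \<Rightarrow> ('s \<Rightarrow> 's \<Rightarrow> 's) \<Rightarrow> nat \<Rightarrow> ('s \<Rightarrow> 'k::field mat) \<Rightarrow> bool" where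
  "fd_rep A m n \<rho> \<longleftrightarrow>
     (\<forall>s\<in>A. \<rho> s \<in> carrier_mat n n) \<and>
     (\<forall>s\<in>A. \<forall>t\<in>A. \<rho> (m s t) = \<rho> s * \<rho> t) \<and>
     LinearCombinations.module.span class_ring (module_vec TYPE('k) n)
       {\<rho> s *\<^sub>v v | s v. s \<in> A \<and> v \<in> carrier_vec n} = carrier_vec n"

definition irreducible_fd_rep ::
  "'s set \<Rightarrow> ('s \<Rightarrow> 's \<Rightarrow> 's) \<Rightarrow> nat \<Rightarrow> ('s \<Rightarrow> 'k::field mat) \<Rightarrow> bool" where
  "irreducible_fd_rep A m n \<rho> \<longleftrightarrow>
     fd_rep A m n \<rho> \<and> n \<noteq> 0 \<and>
     (\<forall>W. VectorSpace.subspace class_ring W (module_vec TYPE('k) n) \<and>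
          (\<forall>s\<in>A. \<forall>w\<in>W. \<rho> s *\<^sub>v w \<in> W) \<longrightarrow>
          W = {0\<^sub>v n} \<or> W = carrier_vec n)"

end

theory Submission
  imports Defs
begin

text \<open>
  A finite index character \<open>\<phi>\<close> and an irreducible representation \<open>\<psi>\<close> of \<open>G\<^sub>\<phi>\<close> induce a
  representation of \<open>S\<close> by block matrices over the orbit of \<open>\<phi>\<close>; with \<open>t\<^sub>i\<close> moving \<open>\<phi>\<close> to the
  \<open>i\<close>-th point of the orbit, the \<open>(j, i)\<close> block of \<open>s\<close> is \<open>\<psi>[t\<^sub>j\<^sup>\<star> s t\<^sub>i, \<phi>]\<close>, or 0 if
  \<open>t\<^sub>j\<^sup>\<star> s t\<^sub>i\<close> is not in \<open>S\<^sub>\<phi>\<close>. It is irreducible, and its block at \<open>\<phi>\<close> recovers \<open>\<psi>\<close>. Elements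
  \<open>s, t\<close> not separated by irreducible representations have \<open>s\<^sup>\<star> s, t\<^sup>\<star> t\<close> and \<open>s s\<^sup>\<star>, t t\<^sup>\<star>\<close> not
  separated either, so condition (1) gives \<open>s\<^sup>\<star> s = t\<^sup>\<star> t\<close>, \<open>s s\<^sup>\<star> = t t\<^sup>\<star>\<close>, and condition (2)
  applied to \<open>t\<^sup>\<star> s\<close> gives \<open>t\<^sup>\<star> s = t\<^sup>\<star> t\<close>.

  Conversely, let \<open>\<rho>\<close> be an irreducible representation on \<open>V\<close>. The idempotents \<open>e\<close> whose image is
  primitive in \<open>\<rho>(E(S))\<close> fall into finitely many classes under \<open>\<rho>\<close>, each defines a character by
  \<open>f \<mapsto> [\<rho>(f e) = \<rho>(e)]\<close>, and \<open>S\<close> permutes them up to zero. So these characters have finite index,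
  the weight spaces \<open>\<rho>(e)V\<close> span \<open>V\<close>, and each is an irreducible representation of the isotropy
  group. Whatever \<open>\<rho>\<close> separates is separated on some weight space.
\<close>

section \<open>Inverse semigroups: the star, commuting idempotents and the natural order\<close>

lemma star_eqI:
  assumes "s * t * s = s" "t * s * t = t" shows "s\<^sup>\<star> = t"
  unfolding star_def by (rule the1_equality[OF ex1_star]) (use assms in auto)

lemma star_inverse: "s * s\<^sup>\<star> * s = s" "s\<^sup>\<star> * s * s\<^sup>\<star> = s\<^sup>\<star>"
  using theI'[OF ex1_star[of s]] unfolding star_def by auto

lemma star_cancel [simp]:
  "s * (s\<^sup>\<star> * s) = s" "s\<^sup>\<star> * (s * s\<^sup>\<star>) = s\<^sup>\<star>"
  "s * (s\<^sup>\<star> * (s * x)) = s * x" "s\<^sup>\<star> * (s * (s\<^sup>\<star> * x)) = s\<^sup>\<star> * x"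
  by (simp_all add: star_inverse flip: mult.assoc)

lemma star_star [simp]: "(s\<^sup>\<star>)\<^sup>\<star> = s"
  by (rule star_eqI) (simp_all add: star_inverse)

lemma idemsI: "e * e = e \<Longrightarrow> e \<in> idems"
  by (simp add: idems_def)

lemma idems_square [simp]:
  assumes "e \<in> idems" shows "e * e = e" "e * (e * x) = e * x"
  using assms by (auto simp: idems_def simp flip: mult.assoc)

lemma star_idem [simp]: "e \<in> idems \<Longrightarrow> e\<^sup>\<star> = e"
  by (rule star_eqI) simp_all

lemma star_mult_in_idems [simp]: "s\<^sup>\<star> * s \<in> idems" "s * s\<^sup>\<star> \<in> idems"
  by (rule idemsI, simp add: mult.assoc)+

text \<open>\<open>f (e f)\<^sup>\<star> e\<close> is an idempotent inverse of \<open>e f\<close>, so it equals \<open>(e f)\<^sup>\<star>\<close>, and an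
  element with an idempotent inverse is that inverse.\<close>

lemma idems_mult [simp]:
  assumes e: "e \<in> idems" and f: "f \<in> idems" shows "e * f \<in> idems"
proof -
  define x where "x = (e * f)\<^sup>\<star>"
  have x1: "e * (f * (x * (e * f))) = e * f" and x2: "x * (e * (f * x)) = x"
    using star_inverse[of "e * f"] unfolding x_def by (simp_all add: mult.assoc)
  have x2': "x * (e * (f * (x * y))) = x * y" for y
    using arg_cong[OF x2, of "\<lambda>z. z * y"] by (simp add: mult.assoc)
  have "(e * f)\<^sup>\<star> = f * x * e"
    by (rule star_eqI) (simp_all add: mult.assoc e f x1 x2')
  then have xe: "x = f * x * e" by (simp only: x_def[symmetric])
  have "x * x = f * (x * (e * (f * (x * e))))"
    using arg_cong2[OF xe xe, of "(*)"] by (simp only: mult.assoc)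
  also have "\<dots> = f * x * e" by (simp add: x2' mult.assoc)
  also have "\<dots> = x" using xe by (rule sym)
  finally have "x \<in> idems" by (rule idemsI)
  moreover have "e * f = x\<^sup>\<star>" by (simp add: x_def)
  ultimately show ?thesis by simp
qed

text \<open>Since \<open>e f\<close> and \<open>f e\<close> are both idempotent, they are inverse to
  each other; but an idempotent is its own inverse.\<close>

lemma idems_commute:
  assumes e: "e \<in> idems" and f: "f \<in> idems" shows "e * f = f * e"
proof -
  have "e * f * (e * f) = e * f" "f * e * (f * e) = f * e"
    using idems_square(1)[OF idems_mult] e f by blast+
  then have "(e * f)\<^sup>\<star> = f * e"
    by (intro star_eqI) (simp_all add: mult.assoc e f)
  then show ?thesis using e f by simp
qed

lemma idems_left_commute:
  assumes "e \<in> idems" "f \<in> idems" shows "e * (f * x) = f * (e * x)"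
  by (simp only: mult.assoc[symmetric] idems_commute[OF assms])

text \<open>The idempotents \<open>t t\<^sup>\<star>\<close> and \<open>s\<^sup>\<star> s\<close>
  meet in the middle of the product; commuting them lets both factors cancel.\<close>

lemma star_mult: "(s * t)\<^sup>\<star> = t\<^sup>\<star> * s\<^sup>\<star>"
proof (rule star_eqI)
  have *: "t * (t\<^sup>\<star> * (s\<^sup>\<star> * (s * x))) = s\<^sup>\<star> * (s * (t * (t\<^sup>\<star> * x)))" for x
    using idems_left_commute[of "t * t\<^sup>\<star>" "s\<^sup>\<star> * s" x] by (simp add: mult.assoc)
  show "s * t * (t\<^sup>\<star> * s\<^sup>\<star>) * (s * t) = s * t" by (simp add: mult.assoc *)
  show "t\<^sup>\<star> * s\<^sup>\<star> * (s * t) * (t\<^sup>\<star> * s\<^sup>\<star>) = t\<^sup>\<star> * s\<^sup>\<star>" by (simp add: mult.assoc flip: *)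
qed

text \<open>Squaring \<open>t e t\<^sup>\<star>\<close> produces \<open>t\<^sup>\<star> t\<close>
  between two copies of \<open>e\<close>, and it commutes past \<open>e\<close> and is absorbed. The
  second form is the first one for \<open>s\<^sup>\<star>\<close>.\<close>

lemma conj_idem:
  assumes e: "e \<in> idems" shows "s * (e * s\<^sup>\<star>) \<in> idems" "s\<^sup>\<star> * (e * s) \<in> idems"
proof -
  have *: "t * (e * t\<^sup>\<star>) \<in> idems" for t
  proof -
    have "t * (e * (t\<^sup>\<star> * (t * (e * t\<^sup>\<star>)))) = t * (e * t\<^sup>\<star>)"
      using idems_left_commute[of e "t\<^sup>\<star> * t" "e * t\<^sup>\<star>"] e by (simp add: mult.assoc)
    then show ?thesis by (intro idemsI) (simp add: mult.assoc)
  qed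
  show "s * (e * s\<^sup>\<star>) \<in> idems" "s\<^sup>\<star> * (e * s) \<in> idems"
    using *[of s] *[of "s\<^sup>\<star>"] by simp_all
qed

text \<open>An idempotent crosses \<open>s\<close> from right to left at the price of a conjugation.
  This makes the natural order, defined by left multiplication, symmetric in left and right.\<close>

lemma mult_idem_right:
  assumes "f \<in> idems" shows "s * f = s * (f * s\<^sup>\<star>) * s"
  using idems_commute[of f "s\<^sup>\<star> * s"] assms by (simp add: mult.assoc)

lemma nat_le_refl: "s \<preceq> s"
  unfolding nat_le_def by (rule bexI[of _ "s * s\<^sup>\<star>"]) (simp_all add: star_inverse)

lemma nat_le_trans:
  assumes "s \<preceq> t" "t \<preceq> u" shows "s \<preceq> u"
proof -
  obtain e f where "e \<in> idems" "f \<in> idems" "s = (e * f) * u"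
    using assms by (auto simp: nat_le_def mult.assoc)
  then show ?thesis unfolding nat_le_def using idems_mult by blast
qed

lemma nat_le_mult:
  assumes "u \<preceq> s" "v \<preceq> t" shows "u * v \<preceq> s * t"
proof -
  obtain e f where ef: "e \<in> idems" "f \<in> idems" "u = e * s" "v = f * t"
    using assms by (auto simp: nat_le_def)
  have "u * v = e * (s * f) * t" by (simp add: ef mult.assoc)
  also have "\<dots> = (e * (s * (f * s\<^sup>\<star>))) * (s * t)"
    unfolding mult_idem_right[OF ef(2), of s] by (simp add: mult.assoc)
  finally show ?thesis
    unfolding nat_le_def using idems_mult[OF ef(1) conj_idem(1)[OF ef(2), of s]] by blast
qed

lemma nat_le_idem_mult: "e \<in> idems \<Longrightarrow> e * s \<preceq> s"
  by (auto simp: nat_le_def)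

lemma nat_le_mult_idem:
  assumes "e \<in> idems" shows "s * e \<preceq> s"
  using nat_le_idem_mult[of "s * (e * s\<^sup>\<star>)" s] conj_idem(1)[OF assms]
  unfolding mult_idem_right[OF assms, symmetric] by blast

text \<open>An element below \<open>s\<close> is the restriction of \<open>s\<close> to its own
  domain idempotent. This later shows that \<open>s\<close> and \<open>u\<close> act alike wherever
  \<open>u\<^sup>\<star> u\<close> acts as the identity.\<close>

lemma nat_le_star_mult: "u \<preceq> s \<Longrightarrow> u = s * (u\<^sup>\<star> * u)"
proof -
  assume "u \<preceq> s"
  then obtain e where e: "e \<in> idems" "u = e * s" by (auto simp: nat_le_def)
  have "s * (u\<^sup>\<star> * u) = s * (s\<^sup>\<star> * (e * s))" using e by (simp add: star_mult mult.assoc)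
  also have "\<dots> = e * s"
    using idems_left_commute[of "s * s\<^sup>\<star>" e s] e by (simp add: mult.assoc)
  finally show ?thesis using e by simp
qed


section \<open>The spectral action\<close>

lemma character_values:
  "\<chi> \<in> characters \<Longrightarrow> e \<in> idems \<Longrightarrow> \<chi> e = 0 \<or> \<chi> e = 1"
  unfolding characters_def by (auto simp: PiE_iff)

lemma character_mult:
  assumes "\<chi> \<in> characters" "e \<in> idems" "f \<in> idems"
  shows "\<chi> (e * f) = 1 \<longleftrightarrow> \<chi> e = 1 \<and> \<chi> f = 1"
proof -
  have "\<chi> (e * f) = min (\<chi> e) (\<chi> f)" using assms unfolding characters_def by auto
  then show ?thesis using character_values[OF assms(1,2)] character_values[OF assms(1,3)] by auto
qed

lemma character_eqI:
  assumes "\<chi> \<in> characters" "\<chi>' \<in> characters"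
    and "\<And>e. e \<in> idems \<Longrightarrow> \<chi> e = 1 \<longleftrightarrow> \<chi>' e = 1"
  shows "\<chi> = \<chi>'"
proof (rule PiE_ext)
  show "\<chi> \<in> idems \<rightarrow>\<^sub>E {0, 1}" "\<chi>' \<in> idems \<rightarrow>\<^sub>E {0, 1}"
    using assms(1,2) unfolding characters_def by auto
  show "\<chi> e = \<chi>' e" if "e \<in> idems" for e
    using assms(3)[OF that] character_values[OF assms(1) that] character_values[OF assms(2) that]
    by auto
qed

text \<open>For values in \<open>{0, 1}\<close> the minimum is logical conjunction, so only the set
  where \<open>\<chi>\<close> is 1 has to be examined.\<close>

lemma characterI:
  assumes "\<And>e. e \<in> idems \<Longrightarrow> \<chi> e \<in> {0, 1}" "\<And>e. e \<notin> idems \<Longrightarrow> \<chi> e = undefined"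
    and "\<And>e f. e \<in> idems \<Longrightarrow> f \<in> idems \<Longrightarrow> \<chi> (e * f) = 1 \<longleftrightarrow> \<chi> e = 1 \<and> \<chi> f = 1"
    and "\<exists>e\<in>idems. \<chi> e = 1"
  shows "\<chi> \<in> characters"
proof -
  have "\<chi> (e * f) = min (\<chi> e) (\<chi> f)" if "e \<in> idems" "f \<in> idems" for e f
    using assms(3)[OF that] assms(1)[of e] assms(1)[of f] assms(1)[of "e * f"] that by fastforce
  moreover have "\<exists>e\<in>idems. \<chi> e \<noteq> 0" using assms(4) by force
  ultimately show ?thesis
    using assms(1,2) unfolding characters_def by (simp add: PiE_iff extensional_def)
qed

lemma act_apply: "e \<in> idems \<Longrightarrow> act s \<chi> e = \<chi> (s\<^sup>\<star> * (e * s))"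
  by (simp add: act_def mult.assoc)

lemma act_undefined: "e \<notin> idems \<Longrightarrow> act s \<chi> e = undefined"
  by (simp add: act_def)

text \<open>The spectral action as a relation with its domain condition built in, because
  \<open>act\<close> is a total function that means something only on that domain. Products and
  stars become composition and converse of partial bijections.\<close>

definition moves ::
    "'a::inverse_semigroup \<Rightarrow> ('a \<Rightarrow> nat) \<Rightarrow> ('a \<Rightarrow> nat) \<Rightarrow> bool" where
  "moves s \<chi> \<chi>' \<longleftrightarrow> \<chi> \<in> characters \<and> \<chi> (s\<^sup>\<star> * s) = 1 \<and> act s \<chi> = \<chi>'"

text \<open>Conjugation by \<open>s\<close> is multiplicative on idempotents, since
  \<open>s s\<^sup>\<star>\<close> can be inserted between \<open>e\<close> and \<open>f\<close>.
  The new character is nonzero because it is 1 at \<open>s s\<^sup>\<star>\<close>.\<close>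

lemma act_in_characters:
  assumes chi: "\<chi> \<in> characters" and s: "\<chi> (s\<^sup>\<star> * s) = 1" shows "act s \<chi> \<in> characters"
proof (rule characterI)
  fix e f :: 'a assume ef: "e \<in> idems" "f \<in> idems"
  have "s\<^sup>\<star> * (e * (f * s)) = s\<^sup>\<star> * (e * s) * (s\<^sup>\<star> * (f * s))"
    using idems_left_commute[of "s * s\<^sup>\<star>" f s] ef by (simp add: mult.assoc)
  then show "act s \<chi> (e * f) = 1 \<longleftrightarrow> act s \<chi> e = 1 \<and> act s \<chi> f = 1"
    using character_mult[OF chi conj_idem(2)[OF ef(1), of s] conj_idem(2)[OF ef(2), of s]] ef
    by (simp add: act_apply mult.assoc)
next
  show "\<exists>e\<in>idems. act s \<chi> e = 1"
    by (rule bexI[of _ "s * s\<^sup>\<star>"]) (simp_all add: act_apply mult.assoc s)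
qed (use character_values[OF chi conj_idem(2)] in \<open>auto simp: act_apply act_undefined\<close>)

lemma moves_characters:
  assumes "moves s \<chi> \<chi>'" shows "\<chi> \<in> characters" "\<chi>' \<in> characters"
  using assms act_in_characters by (auto simp: moves_def)

lemma moves_fun: "moves s \<chi> \<chi>' \<Longrightarrow> moves s \<chi> \<chi>'' \<Longrightarrow> \<chi>' = \<chi>''"
  by (simp add: moves_def)

lemma moves_mult: "moves (s * t) \<chi> \<chi>'' \<longleftrightarrow> (\<exists>\<chi>'. moves t \<chi> \<chi>' \<and> moves s \<chi>' \<chi>'')"
proof (cases "\<chi> \<in> characters")
  case chi: True
  \<comment> \<open>This is the domain idempotent of \<open>s t\<close>. It lies below
    \<open>t\<^sup>\<star> t\<close>, so \<open>t\<close> is defined wherever \<open>s t\<close> is,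
    and \<open>act t \<chi>\<close> sends \<open>s\<^sup>\<star> s\<close> to
    \<open>\<chi> ?e\<close>.\<close>
  let ?e = "t\<^sup>\<star> * (s\<^sup>\<star> * (s * t))"
  have e: "?e \<in> idems" using conj_idem(2)[of "s\<^sup>\<star> * s" t] by (simp add: mult.assoc)
  have "?e = ?e * (t\<^sup>\<star> * t)" by (simp add: mult.assoc)
  then have dom: "\<chi> ?e = 1 \<Longrightarrow> \<chi> (t\<^sup>\<star> * t) = 1"
    using character_mult[OF chi e] by (metis star_mult_in_idems(1))
  have "act (s * t) \<chi> = act s (act t \<chi>)"
  proof
    fix f show "act (s * t) \<chi> f = act s (act t \<chi>) f"
      by (cases "f \<in> idems")
        (simp_all add: act_apply act_undefined conj_idem star_mult mult.assoc)
  qed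
  moreover have "act t \<chi> (s\<^sup>\<star> * s) = \<chi> ?e" by (simp add: act_apply mult.assoc)
  ultimately show ?thesis
    using chi dom act_in_characters[OF chi, of t]
    by (auto simp: moves_def star_mult mult.assoc)
qed (simp add: moves_def)

text \<open>Conjugating \<open>e\<close> forth and back multiplies it by
  \<open>s\<^sup>\<star> s\<close>, where \<open>\<chi>\<close> has value 1.\<close>

lemma moves_star:
  assumes "moves s \<chi> \<chi>'" shows "moves (s\<^sup>\<star>) \<chi>' \<chi>"
proof -
  note m = assms[unfolded moves_def]
  have "act (s\<^sup>\<star>) (act s \<chi>) = \<chi>"
  proof
    fix e show "act (s\<^sup>\<star>) (act s \<chi>) e = \<chi> e"
    proof (cases "e \<in> idems")
      case e: True
      have *: "s\<^sup>\<star> * (s * (e * (s\<^sup>\<star> * s))) = (s\<^sup>\<star> * s) * e"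
        using idems_commute[of e "s\<^sup>\<star> * s"] e by (simp add: mult.assoc)
      have "(\<chi> (s\<^sup>\<star> * s * e) = 1) = (\<chi> e = 1)"
        using m e character_mult[of \<chi> "s\<^sup>\<star> * s" e] by simp
      then have "\<chi> (s\<^sup>\<star> * s * e) = \<chi> e"
        using character_values[of \<chi> e] character_values[of \<chi> "s\<^sup>\<star> * s * e"] m e by fastforce
      with * show ?thesis by (simp add: act_apply e conj_idem mult.assoc)
    next
      case False
      then show ?thesis using m by (auto simp: act_undefined characters_def PiE_iff extensional_def)
    qed
  qed
  moreover have "\<chi>' (s * s\<^sup>\<star>) = 1" using m by (auto simp: act_apply mult.assoc)
  ultimately show ?thesis
    using m moves_characters(2)[OF assms] by (auto simp: moves_def)
qed

lemma moves_inj: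
  assumes "moves s \<chi> \<chi>''" "moves s \<chi>' \<chi>''" shows "\<chi> = \<chi>'"
  using assms moves_star moves_fun by blast

text \<open>An idempotent partial bijection is a partial identity: from \<open>e e = e\<close>, the
  image of \<open>\<chi>\<close> is sent to itself, and injectivity identifies it with
  \<open>\<chi>\<close>.\<close>

lemma moves_idem:
  assumes "e \<in> idems"
  shows "moves e \<chi> \<chi>' \<longleftrightarrow> \<chi> \<in> characters \<and> \<chi> e = 1 \<and> \<chi>' = \<chi>"
proof -
  have *: "\<chi>' = \<chi>" if m: "moves e \<chi> \<chi>'" for \<chi>'
  proof -
    have "moves (e * e) \<chi> \<chi>'" using m assms by simp
    then obtain \<chi>'' where "moves e \<chi> \<chi>''" "moves e \<chi>'' \<chi>'" by (auto simp: moves_mult)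
    then show ?thesis using m moves_fun moves_inj by metis
  qed
  moreover have "moves e \<chi> (act e \<chi>)" if "\<chi> \<in> characters" "\<chi> e = 1"
    using that assms by (simp add: moves_def)
  moreover have "\<chi> \<in> characters \<and> \<chi> e = 1" if "moves e \<chi> \<chi>'"
    using that assms by (simp add: moves_def)
  ultimately show ?thesis by metis
qed

lemma moves_mono:
  assumes "s \<preceq> t" "moves s \<chi> \<chi>'" shows "moves t \<chi> \<chi>'"
  using assms by (auto simp: nat_le_def moves_mult moves_idem)

section \<open>The maximal group image\<close>

context
  fixes \<phi> :: "'a::inverse_semigroup \<Rightarrow> nat"
  assumes phi: "\<phi> \<in> characters"
begin

lemma stab_iff_moves: "s \<in> stab \<phi> \<longleftrightarrow> moves s \<phi> \<phi>"
  using phi by (auto simp: stab_def moves_def)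

lemma stab_mult: "s \<in> stab \<phi> \<Longrightarrow> t \<in> stab \<phi> \<Longrightarrow> s * t \<in> stab \<phi>"
  by (auto simp: stab_iff_moves moves_mult)

lemma stab_idem: "e \<in> idems \<Longrightarrow> e \<in> stab \<phi> \<longleftrightarrow> \<phi> e = 1"
  by (simp add: stab_iff_moves moves_idem phi)

text \<open>With \<open>u = e t\<close> and \<open>v = f t\<close> the bound is
  \<open>e v = f u\<close>. This is what makes \<open>germ_rel\<close> transitive.\<close>

lemma stab_common_lower_bound:
  assumes "u \<in> stab \<phi>" "v \<in> stab \<phi>" "u \<preceq> t" "v \<preceq> t"
  shows "\<exists>z\<in>stab \<phi>. z \<preceq> u \<and> z \<preceq> v"
proof -
  obtain e f where ef: "e \<in> idems" "f \<in> idems" "u = e * t" "v = f * t"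
    using assms by (auto simp: nat_le_def)
  have "moves (e * v) \<phi> \<phi>"
    using assms(1,2) ef(1,3) by (auto simp: stab_iff_moves moves_mult moves_idem)
  moreover have "e * v = f * u" using ef idems_left_commute by auto
  ultimately show ?thesis
    using nat_le_idem_mult ef(1,2) by (metis stab_iff_moves)
qed

lemma equiv_germ_rel: "equiv (stab \<phi>) (germ_rel \<phi>)"
proof (rule equivI)
  show "refl_on (stab \<phi>) (germ_rel \<phi>)"
    unfolding refl_on_def germ_rel_def using nat_le_refl by blast
  show "germ_rel \<phi> \<subseteq> stab \<phi> \<times> stab \<phi>" by (auto simp: germ_rel_def)
  show "sym (germ_rel \<phi>)" unfolding sym_def germ_rel_def by auto
  show "trans (germ_rel \<phi>)"
  proof (rule transI)
    fix s t w assume "(s, t) \<in> germ_rel \<phi>" "(t, w) \<in> germ_rel \<phi>"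
    then obtain u v where uv: "s \<in> stab \<phi>" "w \<in> stab \<phi>" "u \<in> stab \<phi>" "v \<in> stab \<phi>"
      "u \<preceq> s" "u \<preceq> t" "v \<preceq> t" "v \<preceq> w" unfolding germ_rel_def by auto
    then obtain z where "z \<in> stab \<phi>" "z \<preceq> u" "z \<preceq> v"
      using stab_common_lower_bound by blast
    then show "(s, w) \<in> germ_rel \<phi>"
      unfolding germ_rel_def using uv nat_le_trans by blast
  qed
qed

lemma germ_eq_iff:
  assumes "s \<in> stab \<phi>" "t \<in> stab \<phi>"
  shows "germ s \<phi> = germ t \<phi> \<longleftrightarrow> (\<exists>u\<in>stab \<phi>. u \<preceq> s \<and> u \<preceq> t)"
  using eq_equiv_class_iff[OF equiv_germ_rel assms] assms by (auto simp: germ_def germ_rel_def)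

text \<open>The smaller element is itself the common lower bound.\<close>

lemma germ_eq_of_le:
  assumes "s \<in> stab \<phi>" "s \<preceq> t" shows "t \<in> stab \<phi>" "germ s \<phi> = germ t \<phi>"
  using assms moves_mono germ_eq_iff nat_le_refl stab_iff_moves by blast+

lemma in_germ_iff: "t \<in> germ s \<phi> \<longleftrightarrow> s \<in> stab \<phi> \<and> t \<in> stab \<phi> \<and> germ s \<phi> = germ t \<phi>"
proof -
  have "t \<in> germ s \<phi> \<longleftrightarrow> s \<in> stab \<phi> \<and> t \<in> stab \<phi> \<and> (\<exists>u\<in>stab \<phi>. u \<preceq> s \<and> u \<preceq> t)"
    by (simp add: germ_def germ_rel_def)
  then show ?thesis using germ_eq_iff by blast
qed

lemma carrier_isotropy: "carrier (isotropy_group \<phi>) = (\<lambda>s. germ s \<phi>) ` stab \<phi>"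
  by (auto simp: isotropy_group_def quotient_def germ_def)

text \<open>Products of lower bounds are lower bounds of products, so the union defining the product
  in \<open>isotropy_group\<close> runs over a nonempty constant family.\<close>

lemma mult_isotropy:
  assumes s: "s \<in> stab \<phi>" and t: "t \<in> stab \<phi>"
  shows "mult (isotropy_group \<phi>) (germ s \<phi>) (germ t \<phi>) = germ (s * t) \<phi>"
proof -
  have *: "germ (s' * t') \<phi> = germ (s * t) \<phi>" if "s' \<in> germ s \<phi>" "t' \<in> germ t \<phi>" for s' t'
  proof -
    from that obtain u v where "s' \<in> stab \<phi>" "t' \<in> stab \<phi>" "u \<in> stab \<phi>" "v \<in> stab \<phi>"
      "u \<preceq> s'" "u \<preceq> s" "v \<preceq> t'" "v \<preceq> t" by (auto simp: germ_def germ_rel_def)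
    then have "u * v \<in> stab \<phi>" "u * v \<preceq> s' * t'" "u * v \<preceq> s * t"
      "s' * t' \<in> stab \<phi>" "s * t \<in> stab \<phi>"
      using s t by (simp_all add: stab_mult nat_le_mult)
    then show ?thesis using germ_eq_iff by blast
  qed
  have "s \<in> germ s \<phi>" "t \<in> germ t \<phi>" using s t by (simp_all add: in_germ_iff)
  then have "(\<Union>s'\<in>germ s \<phi>. \<Union>t'\<in>germ t \<phi>. germ (s * t) \<phi>) = germ (s * t) \<phi>" by blast
  then show ?thesis by (simp add: isotropy_group_def * cong: SUP_cong)
qed

end


section \<open>Finite dimensional representations\<close>

lemma mult_mat_entry:
  assumes "A \<in> carrier_mat n m" "B \<in> carrier_mat m p" "i < n" "j < p"
  shows "(A * B) $$ (i, j) = (\<Sum>t<m. A $$ (i, t) * B $$ (t, j))"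
  using assms by (simp add: scalar_prod_def lessThan_atLeast0)

lemma mult_mat_vec_entry:
  assumes "A \<in> carrier_mat n m" "v \<in> carrier_vec m" "i < n"
  shows "(A *\<^sub>v v) $ i = (\<Sum>t<m. A $$ (i, t) * v $ t)"
  using assms by (simp add: scalar_prod_def lessThan_atLeast0)

lemma mat_eqI_vec:
  fixes A :: "'k::field mat"
  assumes A: "A \<in> carrier_mat n m" and B: "B \<in> carrier_mat n m"
    and eq: "\<And>v. v \<in> carrier_vec m \<Longrightarrow> A *\<^sub>v v = B *\<^sub>v v"
  shows "A = B"
proof (rule eq_matI)
  fix i j assume ij: "i < dim_row B" "j < dim_col B"
  have "A *\<^sub>v unit_vec m j = B *\<^sub>v unit_vec m j" by (rule eq) simp
  then have "(A *\<^sub>v unit_vec m j) $ i = (B *\<^sub>v unit_vec m j) $ i" by simp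
  then show "A $$ (i, j) = B $$ (i, j)" using A B ij by simp
qed (use A B in auto)

section \<open>Linear subspaces and a criterion for irreducibility\<close>

text \<open>An elementary form of the library's subspaces of \<open>module_vec\<close>, so that
  closure can be checked on vectors directly.\<close>

definition lin_subspace :: "nat \<Rightarrow> 'k::field vec set \<Rightarrow> bool" where
  "lin_subspace n W \<longleftrightarrow> W \<subseteq> carrier_vec n \<and> 0\<^sub>v n \<in> W \<and>
     (\<forall>v\<in>W. \<forall>w\<in>W. v + w \<in> W) \<and> (\<forall>c. \<forall>v\<in>W. c \<cdot>\<^sub>v v \<in> W)"

lemma submodule_iff_lin_subspace:
  "LinearCombinations.submodule class_ring W (module_vec TYPE('k::field) n) \<longleftrightarrow> lin_subspace n W"
  unfolding LinearCombinations.submodule_def lin_subspace_def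
  by (simp add: vec_module module_vec_simps class_ring_simps) blast

lemma subspace_iff_lin_subspace:
  "VectorSpace.subspace class_ring W (module_vec TYPE('k::field) n) \<longleftrightarrow> lin_subspace n W"
  unfolding VectorSpace.subspace_def by (simp add: vec_vs submodule_iff_lin_subspace)

lemma span_properties:
  fixes X :: "'k::field vec set"
  assumes X: "X \<subseteq> carrier_vec n"
  defines "sp \<equiv> LinearCombinations.module.span class_ring (module_vec TYPE('k) n) X"
  shows "lin_subspace n sp" "X \<subseteq> sp" "lin_subspace n W \<Longrightarrow> X \<subseteq> W \<Longrightarrow> sp \<subseteq> W"
proof -
  interpret vec_space "TYPE('k)" n .
  show "lin_subspace n sp"
    using span_is_submodule[of X] X unfolding sp_def by (simp add: submodule_iff_lin_subspace)
  show "X \<subseteq> sp" unfolding sp_def using in_own_span[of X] X by simp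
  show "sp \<subseteq> W" if "lin_subspace n W" "X \<subseteq> W"
    using span_is_subset[of X W] that unfolding sp_def by (simp add: submodule_iff_lin_subspace)
qed

lemma lin_subspace_zero: "lin_subspace n {0\<^sub>v n}"
  by (auto simp: lin_subspace_def)

lemma mult_mat_vec_zero:
  fixes A :: "'k::field mat"
  assumes "A \<in> carrier_mat n m" shows "A *\<^sub>v 0\<^sub>v m = 0\<^sub>v n"
  using assms by (intro eq_vecI) auto

lemma zero_mult_vec:
  fixes v :: "'k::field vec"
  assumes "v \<in> carrier_vec m" shows "0\<^sub>m n m *\<^sub>v v = 0\<^sub>v n"
  using assms by (intro eq_vecI) auto

lemma lin_subspace_preimage:
  fixes A :: "'k::field mat"
  assumes "lin_subspace n W" "A \<in> carrier_mat n m"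
  shows "lin_subspace m {v \<in> carrier_vec m. A *\<^sub>v v \<in> W}"
  using assms unfolding lin_subspace_def
  by (auto simp: mult_mat_vec_zero mult_add_distrib_mat_vec mult_mat_vec)

text \<open>Used to prove identities between matrices: it then suffices that this subspace is the
  whole space.\<close>

lemma lin_subspace_equalizer:
  fixes A :: "'k::field mat"
  assumes "A \<in> carrier_mat n m" "B \<in> carrier_mat n m"
  shows "lin_subspace m {v \<in> carrier_vec m. A *\<^sub>v v = B *\<^sub>v v}"
  using assms unfolding lin_subspace_def
  by (auto simp: mult_mat_vec_zero mult_add_distrib_mat_vec mult_mat_vec)

text \<open>Non-degeneracy and \<open>n \<noteq> 0\<close> reduce to one nonzero matrix. The span of
  all vectors \<open>\<rho> s v\<close> is an invariant subspace, so it is everything unless it is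
  zero, which happens only if every \<open>\<rho> s\<close> is zero; and for \<open>n = 0\<close>
  every matrix is zero.\<close>

lemma irreducible_fd_rep_iff:
  fixes \<rho> :: "'s \<Rightarrow> 'k::field mat"
  shows "irreducible_fd_rep A m n \<rho> \<longleftrightarrow>
     (\<forall>s\<in>A. \<rho> s \<in> carrier_mat n n) \<and>
     (\<forall>s\<in>A. \<forall>t\<in>A. \<rho> (m s t) = \<rho> s * \<rho> t) \<and>
     (\<exists>s\<in>A. \<rho> s \<noteq> 0\<^sub>m n n) \<and>
     (\<forall>W. lin_subspace n W \<and> (\<forall>s\<in>A. \<forall>w\<in>W. \<rho> s *\<^sub>v w \<in> W) \<longrightarrow>
       W = {0\<^sub>v n} \<or> W = carrier_vec n)"
    (is "_ \<longleftrightarrow> ?c \<and> ?m \<and> ?z \<and> ?irr")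
proof (cases ?c)
  case c: True
  let ?X = "{\<rho> s *\<^sub>v v | s v. s \<in> A \<and> v \<in> carrier_vec n}"
  let ?sp = "LinearCombinations.module.span class_ring (module_vec TYPE('k) n) ?X"
  have X: "?X \<subseteq> carrier_vec n" using c by auto
  note sp = span_properties[OF X]
  have "?sp = carrier_vec n \<and> n \<noteq> 0 \<longleftrightarrow> ?z" if irr: ?irr
  proof
    assume *: "?sp = carrier_vec n \<and> n \<noteq> 0"
    show ?z
    proof (rule ccontr)
      assume "\<not> ?z"
      then have "?X \<subseteq> {0\<^sub>v n}" by auto
      then have "carrier_vec n \<subseteq> {0\<^sub>v n :: 'k vec}"
        using sp(3)[OF lin_subspace_zero] * by simp
      then have "unit_vec n 0 = (0\<^sub>v n :: 'k vec)" using unit_vec_carrier by blast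
      then have "unit_vec n 0 $ 0 = (0\<^sub>v n :: 'k vec) $ 0" by simp
      then show False using * by simp
    qed
  next
    assume ?z
    then obtain s where s: "s \<in> A" "\<rho> s \<noteq> 0\<^sub>m n n" by blast
    have "\<exists>v\<in>carrier_vec n. \<rho> s *\<^sub>v v \<noteq> 0\<^sub>v n"
      using mat_eqI_vec[of "\<rho> s" n n "0\<^sub>m n n"] s c by fastforce
    then have "?sp \<noteq> {0\<^sub>v n}" using sp(2) s by blast
    moreover have "?sp \<subseteq> carrier_vec n" using sp(1) by (simp add: lin_subspace_def)
    then have "\<forall>s\<in>A. \<forall>w\<in>?sp. \<rho> s *\<^sub>v w \<in> ?sp" using sp(2) by blast
    ultimately have "?sp = carrier_vec n" using irr sp(1) by blast
    moreover have "n \<noteq> 0"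
    proof
      assume "n = 0"
      then have "\<rho> s = 0\<^sub>m n n" using s(1) c by (intro eq_matI) auto
      then show False using s(2) by simp
    qed
    ultimately show "?sp = carrier_vec n \<and> n \<noteq> 0" by simp
  qed
  moreover have "irreducible_fd_rep A m n \<rho> \<longleftrightarrow>
      (?c \<and> ?m \<and> ?sp = carrier_vec n) \<and> n \<noteq> 0 \<and> ?irr"
    unfolding irreducible_fd_rep_def fd_rep_def subspace_iff_lin_subspace by (rule refl)
  ultimately show ?thesis using c by argo
qed (auto simp: irreducible_fd_rep_def fd_rep_def)

text \<open>\<open>X\<close> is only an invariant set; the subspace \<open>W\<close> containing it need not be invariant.\<close>

lemma irreducible_generates:
  assumes irr: "irreducible_fd_rep A m n (\<rho> :: 's \<Rightarrow> 'k::field mat)"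
    and X: "X \<subseteq> carrier_vec n" "\<And>s x. s \<in> A \<Longrightarrow> x \<in> X \<Longrightarrow> \<rho> s *\<^sub>v x \<in> X"
    and x: "x \<in> X" "x \<noteq> 0\<^sub>v n"
    and W: "lin_subspace n W" "X \<subseteq> W"
  shows "W = carrier_vec n"
proof -
  let ?sp = "LinearCombinations.module.span class_ring (module_vec TYPE('k) n) X"
  note sp = span_properties[OF X(1)]
  note irr' = irr[unfolded irreducible_fd_rep_iff]
  \<comment> \<open>The preimage of the span under \<open>\<rho> s\<close> is a subspace containing
    \<open>X\<close>, hence it contains the span.\<close>
  have "\<rho> s *\<^sub>v w \<in> ?sp" if "s \<in> A" "w \<in> ?sp" for s w
  proof -
    have "lin_subspace n {v \<in> carrier_vec n. \<rho> s *\<^sub>v v \<in> ?sp}"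
      using irr' that sp(1) by (intro lin_subspace_preimage) auto
    moreover have "X \<subseteq> {v \<in> carrier_vec n. \<rho> s *\<^sub>v v \<in> ?sp}"
      using X that sp(2) by blast
    ultimately show ?thesis using sp(3) that by blast
  qed
  then have "?sp = {0\<^sub>v n} \<or> ?sp = carrier_vec n" using irr' sp(1) by blast
  then have "?sp = carrier_vec n" using x sp(2) by blast
  then show ?thesis using sp(3)[OF W] W(1) by (auto simp: lin_subspace_def)
qed


section \<open>Idempotent matrices\<close>

text \<open>If \<open>n < d\<close>, padding by zeros makes both matrices square without changing
  \<open>C B = 1\<close>. A left inverse of a square matrix is also a right inverse, but row
  \<open>n\<close> of the padded \<open>B\<close> is zero.\<close>

lemma left_inverse_dim_le:
  fixes B :: "'k::field mat"
  assumes B: "B \<in> carrier_mat n d" and C: "C \<in> carrier_mat d n" and CB: "C * B = 1\<^sub>m d"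
  shows "d \<le> n"
proof (rule ccontr)
  assume "\<not> d \<le> n"
  then have nd: "n < d" by simp
  define B' where "B' = mat d d (\<lambda>(i, j). if i < n then B $$ (i, j) else 0)"
  define C' where "C' = mat d d (\<lambda>(i, j). if j < n then C $$ (i, j) else 0)"
  have B': "B' \<in> carrier_mat d d" and C': "C' \<in> carrier_mat d d" by (simp_all add: B'_def C'_def)
  have "C' * B' = 1\<^sub>m d"
  proof (rule eq_matI)
    fix i j assume "i < dim_row (1\<^sub>m d :: 'k mat)" "j < dim_col (1\<^sub>m d :: 'k mat)"
    then have ij: "i < d" "j < d" by auto
    have "(C' * B') $$ (i, j) = (\<Sum>t<d. C' $$ (i, t) * B' $$ (t, j))"
      by (rule mult_mat_entry[OF C' B' ij])
    also have "\<dots> = (\<Sum>t<n. C' $$ (i, t) * B' $$ (t, j))"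
      by (rule sum.mono_neutral_right) (use nd ij in \<open>auto simp: B'_def C'_def\<close>)
    also have "\<dots> = (\<Sum>t<n. C $$ (i, t) * B $$ (t, j))"
      by (rule sum.cong) (use nd ij in \<open>auto simp: B'_def C'_def\<close>)
    also have "\<dots> = 1\<^sub>m d $$ (i, j)" using mult_mat_entry[OF C B ij] CB by simp
    finally show "(C' * B') $$ (i, j) = 1\<^sub>m d $$ (i, j)" .
  qed (use B' C' in auto)
  then have "B' * C' = 1\<^sub>m d" by (rule mat_mult_left_right_inverse[OF C' B'])
  then have "(\<Sum>t<d. B' $$ (n, t) * C' $$ (t, n)) = 1"
    using mult_mat_entry[OF B' C' nd nd] nd by simp
  moreover have "B' $$ (n, t) = 0" if "t < d" for t using that nd by (simp add: B'_def)
  ultimately show False by simp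
qed

lemma nonzero_mat_entry:
  assumes "A \<in> carrier_mat n m" "A \<noteq> 0\<^sub>m n m"
  shows "\<exists>i<n. \<exists>j<m. A $$ (i, j) \<noteq> 0"
proof (rule ccontr)
  assume "\<not> ?thesis"
  then have "A = 0\<^sub>m n m" using assms(1) by (intro eq_matI) auto
  with assms(2) show False ..
qed

text \<open>Pick a nonzero entry of each \<open>P i\<close>, at \<open>(k i, l i)\<close>. Column
  \<open>l j\<close> of \<open>P j\<close> and the scaled row \<open>k i\<close> of
  \<open>P i\<close> pair to the \<open>(k i, l j)\<close> entry of \<open>P i P j\<close> divided
  by that of \<open>P i\<close> at \<open>(k i, l i)\<close>, so the columns have a left
  inverse.\<close>

lemma orthogonal_idempotents_le:
  fixes P :: "nat \<Rightarrow> 'k::field mat"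
  assumes P: "\<And>i. i < d \<Longrightarrow> P i \<in> carrier_mat n n" "\<And>i. i < d \<Longrightarrow> P i \<noteq> 0\<^sub>m n n"
    and idem: "\<And>i. i < d \<Longrightarrow> P i * P i = P i"
    and orth: "\<And>i j. i < d \<Longrightarrow> j < d \<Longrightarrow> i \<noteq> j \<Longrightarrow> P i * P j = 0\<^sub>m n n"
  shows "d \<le> n"
proof -
  have "\<forall>i\<in>{..<d}. \<exists>kl. fst kl < n \<and> snd kl < n \<and> P i $$ kl \<noteq> 0"
    using nonzero_mat_entry[OF P] by force
  from bchoice[OF this] obtain kl where kl': "\<forall>i\<in>{..<d}. fst (kl i) < n \<and> snd (kl i) < n \<and> P i $$ kl i \<noteq> 0"
    by blast
  define k l where "k = fst \<circ> kl" and "l = snd \<circ> kl"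
  have kl: "k i < n" "l i < n" "P i $$ (k i, l i) \<noteq> 0" if "i < d" for i
    using kl' that by (simp_all add: k_def l_def)
  define B where "B = mat n d (\<lambda>(t, j). P j $$ (t, l j))"
  define C where "C = mat d n (\<lambda>(i, t). P i $$ (k i, t) / P i $$ (k i, l i))"
  have B: "B \<in> carrier_mat n d" and C: "C \<in> carrier_mat d n" by (simp_all add: B_def C_def)
  have "C * B = 1\<^sub>m d"
  proof (rule eq_matI)
    fix i j assume "i < dim_row (1\<^sub>m d :: 'k mat)" "j < dim_col (1\<^sub>m d :: 'k mat)"
    then have ij: "i < d" "j < d" by auto
    have "(C * B) $$ (i, j) = (\<Sum>t<n. C $$ (i, t) * B $$ (t, j))"
      by (rule mult_mat_entry[OF C B ij])
    also have "\<dots> = (\<Sum>t<n. P i $$ (k i, t) * P j $$ (t, l j)) / P i $$ (k i, l i)"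
      using ij by (simp add: B_def C_def sum_divide_distrib)
    also have "\<dots> = (P i * P j) $$ (k i, l j) / P i $$ (k i, l i)"
      using mult_mat_entry[OF P(1)[OF ij(1)] P(1)[OF ij(2)] kl(1)[OF ij(1)] kl(2)[OF ij(2)]] by simp
    also have "\<dots> = 1\<^sub>m d $$ (i, j)"
      using idem[OF ij(1)] orth[OF ij] ij kl by (cases "i = j") auto
    finally show "(C * B) $$ (i, j) = 1\<^sub>m d $$ (i, j)" .
  qed (use B C in auto)
  then show ?thesis by (rule left_inverse_dim_le[OF B C])
qed

lemma orthogonal_idempotents_finite:
  fixes S :: "'k::field mat set"
  assumes S: "S \<subseteq> carrier_mat n n" "0\<^sub>m n n \<notin> S"
    and idem: "\<And>p. p \<in> S \<Longrightarrow> p * p = p"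
    and orth: "\<And>p q. p \<in> S \<Longrightarrow> q \<in> S \<Longrightarrow> p \<noteq> q \<Longrightarrow> p * q = 0\<^sub>m n n"
  shows "finite S"
proof (rule ccontr)
  assume "infinite S"
  then obtain T where T: "T \<subseteq> S" "finite T" "card T = Suc n"
    using infinite_arbitrarily_large by blast
  then obtain P where P: "bij_betw P {..<Suc n} T"
    using ex_bij_betw_nat_finite[of T] by (auto simp: lessThan_atLeast0)
  then have PS: "P i \<in> S" if "i < Suc n" for i
    using that T(1) by (auto simp: bij_betw_def)
  have inj: "P i \<noteq> P j" if "i < Suc n" "j < Suc n" "i \<noteq> j" for i j
    using P that by (auto simp: bij_betw_def inj_on_def)
  have "Suc n \<le> n"
  proof (rule orthogonal_idempotents_le)
    show "P i \<in> carrier_mat n n" "P i \<noteq> 0\<^sub>m n n" "P i * P i = P i" if "i < Suc n" for i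
      using PS[OF that] S idem by auto
    show "P i * P j = 0\<^sub>m n n" if "i < Suc n" "j < Suc n" "i \<noteq> j" for i j
      using orth[OF PS PS inj] that by blast
  qed
  then show False by simp
qed

section \<open>The rank of an idempotent matrix and its full rank factorization\<close>

text \<open>\<open>B\<close> embeds a space of dimension \<open>d\<close> in the range of
  \<open>A\<close> and \<open>C\<close> retracts onto it, so \<open>B C\<close> is an idempotent
  below \<open>A\<close>. Equality \<open>B C = A\<close> is left out so that splittings can be
  enlarged step by step.\<close>

definition idem_split :: "'k::field mat \<Rightarrow> nat \<Rightarrow> nat \<Rightarrow> 'k mat \<Rightarrow> 'k mat \<Rightarrow> bool" where
  "idem_split A n d B C \<longleftrightarrow> B \<in> carrier_mat n d \<and> C \<in> carrier_mat d n \<and>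
     C * B = 1\<^sub>m d \<and> A * B = B \<and> C * A = C"

definition idem_rank :: "nat \<Rightarrow> 'k::field mat \<Rightarrow> nat" where
  "idem_rank n A = (GREATEST d. \<exists>B C. idem_split A n d B C)"

lemma idem_split_bound: "idem_split A n d B C \<Longrightarrow> d \<le> n"
  using left_inverse_dim_le by (auto simp: idem_split_def)

lemma idem_rank_ge: "idem_split A n d B C \<Longrightarrow> d \<le> idem_rank n A"
  unfolding idem_rank_def by (rule Greatest_le_nat[where b = n]) (use idem_split_bound in blast)+

text \<open>The difference \<open>Q = A - B C\<close> is a nonzero idempotent orthogonal to
  \<open>B C\<close>, so it has room for one more dimension.\<close>

lemma idem_split_extend:
  fixes A :: "'k::field mat"
  assumes A: "A \<in> carrier_mat n n" and idem: "A * A = A" and sp: "idem_split A n d B C"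
    and neq: "B * C \<noteq> A"
  shows "\<exists>B' C'. idem_split A n (Suc d) B' C'"
proof -
  have B: "B \<in> carrier_mat n d" and C: "C \<in> carrier_mat d n" and CB: "C * B = 1\<^sub>m d"
    and AB: "A * B = B" and CA: "C * A = C" using sp by (auto simp: idem_split_def)
  define Q where "Q = A - B * C"
  have BC: "B * C \<in> carrier_mat n n" using B C by simp
  have Q: "Q \<in> carrier_mat n n" unfolding Q_def using BC by (rule minus_carrier_mat)
  have AQ: "A * Q = Q"
  proof -
    have "A * Q = A * A - A * (B * C)"
      unfolding Q_def by (rule mult_minus_distrib_mat[OF A A BC])
    also have "A * (B * C) = B * C" using assoc_mult_mat[OF A B C] AB by simp
    finally show ?thesis using idem by (simp add: Q_def)
  qed
  have QA: "Q * A = Q"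
  proof -
    have "Q * A = A * A - (B * C) * A"
      unfolding Q_def by (rule minus_mult_distrib_mat[OF A BC A])
    also have "(B * C) * A = B * C" using assoc_mult_mat[OF B C A] CA by simp
    finally show ?thesis using idem by (simp add: Q_def)
  qed
  have CQ: "C * Q = 0\<^sub>m d n"
  proof -
    have "C * Q = C * A - C * (B * C)"
      unfolding Q_def by (rule mult_minus_distrib_mat[OF C A BC])
    also have "C * (B * C) = C" using assoc_mult_mat[OF C B C] CB C by simp
    finally show ?thesis using CA C by simp
  qed
  have QB: "Q * B = 0\<^sub>m n d"
  proof -
    have "Q * B = A * B - (B * C) * B"
      unfolding Q_def by (rule minus_mult_distrib_mat[OF A BC B])
    also have "(B * C) * B = B" using assoc_mult_mat[OF B C B] CB B by simp
    finally show ?thesis using AB B by simp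
  qed
  have QQ: "Q * Q = Q"
  proof -
    have "Q * Q = A * Q - (B * C) * Q"
      using minus_mult_distrib_mat[OF A BC Q] unfolding Q_def .
    also have "(B * C) * Q = 0\<^sub>m n n" using assoc_mult_mat[OF B C Q] CQ B by simp
    also have "A * Q - 0\<^sub>m n n = Q" using AQ Q by (intro eq_matI) auto
    finally show ?thesis .
  qed
  have "Q \<noteq> 0\<^sub>m n n"
  proof
    assume Q0: "Q = 0\<^sub>m n n"
    have "B * C = A"
    proof (rule eq_matI)
      fix i j assume ij: "i < dim_row A" "j < dim_col A"
      then have "Q $$ (i, j) = 0" using Q0 A by simp
      then show "(B * C) $$ (i, j) = A $$ (i, j)" using ij A BC B C unfolding Q_def by simp
    qed (use A B C in auto)
    then show False using neq by simp
  qed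
  then obtain k l where kl: "k < n" "l < n" and q: "Q $$ (k, l) \<noteq> 0"
    using nonzero_mat_entry[OF Q] by blast
  \<comment> \<open>\<open>B\<close> gains column \<open>l\<close> of \<open>Q\<close>, and
    \<open>C\<close> gains row \<open>k\<close> of \<open>Q\<close> divided by the pivot
    \<open>Q $$ (k, l)\<close>. The four blocks of the new product come from \<open>C B = 1\<close>,
    \<open>C Q = 0\<close>, \<open>Q B = 0\<close> and \<open>Q Q = Q\<close>.\<close>
  define B' where "B' = mat n (Suc d) (\<lambda>(i, j). if j < d then B $$ (i, j) else Q $$ (i, l))"
  define C' where
    "C' = mat (Suc d) n (\<lambda>(i, j). if i < d then C $$ (i, j) else Q $$ (k, j) / Q $$ (k, l))"
  have B': "B' \<in> carrier_mat n (Suc d)" and C': "C' \<in> carrier_mat (Suc d) n"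
    by (simp_all add: B'_def C'_def)
  have "C' * B' = 1\<^sub>m (Suc d)"
  proof (rule eq_matI)
    fix i j
    assume "i < dim_row (1\<^sub>m (Suc d) :: 'k mat)" "j < dim_col (1\<^sub>m (Suc d) :: 'k mat)"
    then have ij: "i < Suc d" "j < Suc d" by auto
    have e: "(C' * B') $$ (i, j) = (\<Sum>t<n. C' $$ (i, t) * B' $$ (t, j))"
      by (rule mult_mat_entry[OF C' B' ij])
    consider "i < d" "j < d" | "i < d" "j = d" | "i = d" "j < d" | "i = d" "j = d"
      using ij by linarith
    then show "(C' * B') $$ (i, j) = 1\<^sub>m (Suc d) $$ (i, j)"
    proof cases
      case 1
      then have "(C' * B') $$ (i, j) = (C * B) $$ (i, j)"
        unfolding e mult_mat_entry[OF C B 1] by (simp add: B'_def C'_def)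
      then show ?thesis using 1 CB by simp
    next
      case 2
      then have "(C' * B') $$ (i, j) = (C * Q) $$ (i, l)"
        unfolding e mult_mat_entry[OF C Q 2(1) kl(2)] by (simp add: B'_def C'_def)
      then show ?thesis using 2 CQ kl by simp
    next
      case 3
      then have "(C' * B') $$ (i, j) = (Q * B) $$ (k, j) / Q $$ (k, l)"
        unfolding e mult_mat_entry[OF Q B kl(1) 3(2)]
        by (simp add: B'_def C'_def sum_divide_distrib)
      then show ?thesis using 3 QB kl by simp
    next
      case 4
      then have "(C' * B') $$ (i, j) = (Q * Q) $$ (k, l) / Q $$ (k, l)"
        unfolding e mult_mat_entry[OF Q Q kl]
        by (simp add: B'_def C'_def sum_divide_distrib)
      then show ?thesis using 4 QQ q by simp
    qed
  qed (use B' C' in auto)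
  moreover have "A * B' = B'"
  proof (rule eq_matI)
    fix i j assume "i < dim_row B'" "j < dim_col B'"
    then have ij: "i < n" "j < Suc d" using B' by auto
    show "(A * B') $$ (i, j) = B' $$ (i, j)"
    proof (cases "j < d")
      case True
      have "(A * B') $$ (i, j) = (A * B) $$ (i, j)"
        unfolding mult_mat_entry[OF A B' ij] mult_mat_entry[OF A B ij(1) True]
        using True by (simp add: B'_def)
      then show ?thesis using AB True ij by (simp add: B'_def)
    next
      case False
      have "(A * B') $$ (i, j) = (A * Q) $$ (i, l)"
        unfolding mult_mat_entry[OF A B' ij] mult_mat_entry[OF A Q ij(1) kl(2)]
        using False ij by (simp add: B'_def)
      then show ?thesis using AQ False ij by (simp add: B'_def)
    qed
  qed (use A B' in auto)
  moreover have "C' * A = C'"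
  proof (rule eq_matI)
    fix i j assume "i < dim_row C'" "j < dim_col C'"
    then have ij: "i < Suc d" "j < n" using C' by auto
    show "(C' * A) $$ (i, j) = C' $$ (i, j)"
    proof (cases "i < d")
      case True
      have "(C' * A) $$ (i, j) = (C * A) $$ (i, j)"
        unfolding mult_mat_entry[OF C' A ij] mult_mat_entry[OF C A True ij(2)]
        using True by (simp add: C'_def)
      then show ?thesis using CA True ij by (simp add: C'_def)
    next
      case False
      have "(C' * A) $$ (i, j) = (Q * A) $$ (k, j) / Q $$ (k, l)"
        unfolding mult_mat_entry[OF C' A ij] mult_mat_entry[OF Q A kl(1) ij(2)]
        using False ij by (simp add: C'_def sum_divide_distrib)
      then show ?thesis using QA False ij by (simp add: C'_def)
    qed
  qed (use A C' in auto)
  ultimately show ?thesis using B' C' unfolding idem_split_def by blast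
qed

text \<open>The empty splitting of size 0 and the bound \<open>n\<close> make the maximum exist; a
  maximal splitting cannot be extended, so it exhausts \<open>A\<close>.\<close>

lemma idem_rank_factorization:
  fixes A :: "'k::field mat"
  assumes A: "A \<in> carrier_mat n n" and idem: "A * A = A"
  obtains B C where "idem_split A n (idem_rank n A) B C" "B * C = A"
proof -
  have "(0\<^sub>m 0 n :: 'k mat) * 0\<^sub>m n 0 = 1\<^sub>m 0" by (rule eq_matI) auto
  then have "idem_split A n 0 (0\<^sub>m n 0) (0\<^sub>m 0 n)"
    using A by (simp add: idem_split_def)
  then have "\<exists>B C. idem_split A n 0 B C" by blast
  moreover have "\<forall>d. (\<exists>B C. idem_split A n d B C) \<longrightarrow> d \<le> n" using idem_split_bound by blast
  ultimately have "\<exists>B C. idem_split A n (idem_rank n A) B C"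
    unfolding idem_rank_def
    using GreatestI_nat[of "\<lambda>d. \<exists>B C. idem_split A n d B C" 0 n] by simp
  then obtain B C where sp: "idem_split A n (idem_rank n A) B C" by blast
  have "B * C = A"
  proof (rule ccontr)
    assume "B * C \<noteq> A"
    then obtain B' C' where "idem_split A n (Suc (idem_rank n A)) B' C'"
      using idem_split_extend[OF A idem sp] by blast
    from idem_rank_ge[OF this] show False by simp
  qed
  with sp show thesis by (rule that)
qed

text \<open>A maximal splitting of \<open>Q\<close> also splits \<open>P\<close> without exhausting
  it, so it extends. This is the descent that yields primitive idempotents.\<close>

lemma idem_rank_less:
  fixes P :: "'k::field mat"
  assumes P: "P \<in> carrier_mat n n" "P * P = P" and Q: "Q \<in> carrier_mat n n" "Q * Q = Q"
    and PQ: "P * Q = Q" "Q * P = Q" and neq: "Q \<noteq> P"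
  shows "idem_rank n Q < idem_rank n P"
proof -
  obtain B C where sp: "idem_split Q n (idem_rank n Q) B C" and BC: "B * C = Q"
    using idem_rank_factorization[OF Q] .
  let ?d = "idem_rank n Q"
  have B: "B \<in> carrier_mat n ?d" and C: "C \<in> carrier_mat ?d n" and CB: "C * B = 1\<^sub>m ?d"
    and QB: "Q * B = B" and CQ: "C * Q = C" using sp by (auto simp: idem_split_def)
  have "P * B = B" using assoc_mult_mat[OF P(1) Q(1) B] QB PQ by simp
  moreover have "C * P = C" using assoc_mult_mat[OF C Q(1) P(1)] CQ PQ by simp
  ultimately have "idem_split P n ?d B C" using B C CB by (simp add: idem_split_def)
  moreover have "B * C \<noteq> P" using BC neq by simp
  ultimately obtain B' C' where "idem_split P n (Suc ?d) B' C'"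
    using idem_split_extend[OF P] by blast
  from idem_rank_ge[OF this] show ?thesis by simp
qed


section \<open>Induced representations\<close>

lemma sum_blocks:
  fixes g :: "nat \<Rightarrow> 'b::comm_monoid_add"
  shows "(\<Sum>p<r * d. g p) = (\<Sum>i<r. \<Sum>a<d. g (i * d + a))"
proof -
  have "(\<Sum>p<r * d. g p) = (\<Sum>i<r. sum g {i * d..<i * d + d})"
    by (rule sum.nat_group[symmetric])
  moreover have "sum g {i * d..<i * d + d} = (\<Sum>a<d. g (i * d + a))" for i
    using sum.shift_bounds_nat_ivl[of g 0 "i * d" d] by (simp add: lessThan_atLeast0 add.commute)
  ultimately show ?thesis by simp
qed

text \<open>A representation of the group \<open>G\<^sub>\<phi>\<close>, pulled back to \<open>S\<^sub>\<phi>\<close> and extended by zero.\<close>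

locale stab_rep =
  fixes \<phi> :: "'a::inverse_semigroup \<Rightarrow> nat" and d :: nat and F :: "'a \<Rightarrow> 'k::field mat"
  assumes phi: "\<phi> \<in> characters"
    and d_pos: "0 < d"
    and F_carrier: "F x \<in> carrier_mat d d"
    and F_mult: "x \<in> stab \<phi> \<Longrightarrow> y \<in> stab \<phi> \<Longrightarrow> F (x * y) = F x * F y"
    and F_le: "x \<in> stab \<phi> \<Longrightarrow> x \<preceq> y \<Longrightarrow> F y = F x"
    and F_idem: "e \<in> idems \<Longrightarrow> e \<in> stab \<phi> \<Longrightarrow> F e = 1\<^sub>m d"
    and F_out: "x \<notin> stab \<phi> \<Longrightarrow> F x = 0\<^sub>m d d"
    and F_irreducible: "lin_subspace d U \<Longrightarrow> (\<And>x u. x \<in> stab \<phi> \<Longrightarrow> u \<in> U \<Longrightarrow> F x *\<^sub>v u \<in> U) \<Longrightarrow>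
      U = {0\<^sub>v d} \<or> U = carrier_vec d"

text \<open>\<open>\<chi>\<close> lists the orbit of \<open>\<phi>\<close> without repetition,
  \<open>t\<close> is a transversal and \<open>base\<close> is the index of \<open>\<phi>\<close>
  itself. Requiring \<open>t base\<close> to be idempotent makes the block at \<open>base\<close>
  equal to \<open>F\<close>.\<close>

locale induced_rep = stab_rep \<phi> d F
  for \<phi> :: "'a::inverse_semigroup \<Rightarrow> nat" and d :: nat and F :: "'a \<Rightarrow> 'k::field mat" +
  fixes r :: nat and \<chi> :: "nat \<Rightarrow> 'a \<Rightarrow> nat" and t :: "nat \<Rightarrow> 'a" and base :: nat
  assumes t_moves: "i < r \<Longrightarrow> moves (t i) \<phi> (\<chi> i)"
    and chi_inj: "i < r \<Longrightarrow> j < r \<Longrightarrow> \<chi> i = \<chi> j \<Longrightarrow> i = j"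
    and orbit: "moves x \<phi> \<chi>' \<Longrightarrow> \<exists>i<r. \<chi>' = \<chi> i"
    and base: "base < r" "t base \<in> idems"
begin

lemma chi_characters: "i < r \<Longrightarrow> \<chi> i \<in> characters"
  using t_moves moves_characters by blast

lemma chi_base: "\<chi> base = \<phi>"
  using t_moves[OF base(1)] base(2) by (simp add: moves_idem)

section \<open>Blocks, and the block matrices and block vectors of size \<open>r * d\<close>\<close>

definition blk :: "'a \<Rightarrow> nat \<Rightarrow> nat \<Rightarrow> 'k mat" where
  "blk x j i = F ((t j)\<^sup>\<star> * x * t i)"

text \<open>\<open>t i\<close> carries \<open>\<phi>\<close> to \<open>\<chi> i\<close>, and only
  \<open>\<chi> j\<close> is carried back to \<open>\<phi>\<close> by
  \<open>(t j)\<^sup>\<star>\<close>. Hence every block row and block column of \<open>rho x\<close>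
  has at most one nonzero block.\<close>

lemma stab_block_iff:
  assumes "i < r" "j < r"
  shows "(t j)\<^sup>\<star> * x * t i \<in> stab \<phi> \<longleftrightarrow> moves x (\<chi> i) (\<chi> j)"
proof -
  have j: "moves ((t j)\<^sup>\<star>) (\<chi> j) \<phi>" by (rule moves_star[OF t_moves[OF assms(2)]])
  show ?thesis
  proof
    assume "(t j)\<^sup>\<star> * x * t i \<in> stab \<phi>"
    then obtain \<alpha> \<beta> where *: "moves (t i) \<phi> \<alpha>" "moves x \<alpha> \<beta>" "moves ((t j)\<^sup>\<star>) \<beta> \<phi>"
      unfolding stab_iff_moves[OF phi] moves_mult by blast
    have "\<chi> i = \<alpha>" by (rule moves_fun[OF t_moves[OF assms(1)] *(1)])
    moreover have "\<chi> j = \<beta>" by (rule moves_inj[OF j *(3)])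
    ultimately show "moves x (\<chi> i) (\<chi> j)" using *(2) by simp
  next
    assume "moves x (\<chi> i) (\<chi> j)"
    then show "(t j)\<^sup>\<star> * x * t i \<in> stab \<phi>"
      using t_moves[OF assms(1)] j unfolding stab_iff_moves[OF phi] moves_mult by blast
  qed
qed

lemma orbit_closed:
  assumes "i < r" "moves x (\<chi> i) \<chi>'" shows "\<exists>j<r. \<chi>' = \<chi> j"
proof (rule orbit)
  show "moves (x * t i) \<phi> \<chi>'" using t_moves assms by (auto simp: moves_mult)
qed

lemma blk_carrier: "blk x j i \<in> carrier_mat d d"
  by (simp add: blk_def F_carrier)

lemma blk_zero:
  assumes "i < r" "j < r" "\<not> moves x (\<chi> i) (\<chi> j)" shows "blk x j i = 0\<^sub>m d d"
  unfolding blk_def by (rule F_out) (simp add: stab_block_iff assms)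

text \<open>The product of the two arguments of \<open>F\<close> contains the idempotent
  \<open>t j (t j)\<^sup>\<star>\<close>. Dropping it only goes up in the natural order, along which
  \<open>F\<close> is constant. If \<open>x\<close> does not move \<open>\<chi> j\<close> to
  \<open>\<chi> k\<close>, both sides vanish.\<close>

lemma blk_mult:
  assumes ijk: "i < r" "j < r" "k < r" and y: "moves y (\<chi> i) (\<chi> j)"
  shows "blk x k j * blk y j i = blk (x * y) k i"
proof (cases "moves x (\<chi> j) (\<chi> k)")
  case True
  let ?a = "(t k)\<^sup>\<star> * x * t j" and ?b = "(t j)\<^sup>\<star> * y * t i"
  have ab: "?a \<in> stab \<phi>" "?b \<in> stab \<phi>" using True y ijk by (simp_all add: stab_block_iff)
  have "x * (t j * (t j)\<^sup>\<star>) * (y * t i) \<preceq> x * (y * t i)"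
    by (intro nat_le_mult nat_le_mult_idem nat_le_refl) simp
  then have "(t k)\<^sup>\<star> * (x * (t j * (t j)\<^sup>\<star>) * (y * t i)) \<preceq> (t k)\<^sup>\<star> * (x * (y * t i))"
    by (rule nat_le_mult[OF nat_le_refl])
  then have "?a * ?b \<preceq> (t k)\<^sup>\<star> * (x * y) * t i" by (simp add: mult.assoc)
  then show ?thesis
    unfolding blk_def using F_le[OF stab_mult[OF phi ab]] F_mult[OF ab] by simp
next
  case False
  then have "\<not> moves (x * y) (\<chi> i) (\<chi> k)" 
    unfolding moves_mult using moves_fun[OF y] by auto
  then show ?thesis
    using False ijk blk_carrier[of y j i] by (simp add: blk_zero)
qed

lemma blk_idem:
  assumes "e \<in> idems" "k < r" "\<chi> k e = 1" shows "blk e k k = 1\<^sub>m d"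
  unfolding blk_def
proof (rule F_idem)
  show "(t k)\<^sup>\<star> * e * t k \<in> idems" using conj_idem(2)[OF assms(1)] by (simp add: mult.assoc)
  show "(t k)\<^sup>\<star> * e * t k \<in> stab \<phi>"
    using assms chi_characters by (simp add: stab_block_iff moves_idem)
qed

definition rho :: "'a \<Rightarrow> 'k mat" where
  "rho x = mat (r * d) (r * d) (\<lambda>(p, q). blk x (p div d) (q div d) $$ (p mod d, q mod d))"

definition bl :: "nat \<Rightarrow> 'k vec \<Rightarrow> 'k vec" where
  "bl i v = vec d (\<lambda>a. v $ (i * d + a))"

definition emb :: "nat \<Rightarrow> 'k vec \<Rightarrow> 'k vec" where
  "emb i u = vec (r * d) (\<lambda>p. if p div d = i then u $ (p mod d) else 0)"

lemma rho_carrier [simp]: "rho x \<in> carrier_mat (r * d) (r * d)"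
  by (simp add: rho_def)

lemma bl_carrier [simp]: "bl i v \<in> carrier_vec d"
  by (simp add: bl_def)

lemma emb_carrier [simp]: "emb i v \<in> carrier_vec (r * d)"
  by (simp add: emb_def)

lemma block_index: "i < r \<Longrightarrow> a < d \<Longrightarrow> i * d + a < r * d"
proof -
  assume "i < r" "a < d"
  then have "i * d + a < Suc i * d" by simp
  also have "\<dots> \<le> r * d" using \<open>i < r\<close> by (intro mult_le_mono1) simp
  finally show ?thesis .
qed

lemma block_index_split:
  assumes "p < r * d" shows "p div d < r" "p mod d < d" "p div d * d + p mod d = p"
  using assms d_pos by (simp_all add: less_mult_imp_div_less)

lemma rho_entry:
  assumes "i < r" "j < r" "a < d" "b < d"
  shows "rho x $$ (i * d + a, j * d + b) = blk x i j $$ (a, b)"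
  using assms block_index by (simp add: rho_def)

lemma rho_mult: "rho (x * y) = rho x * rho y"
proof (rule eq_matI)
  fix p q assume "p < dim_row (rho x * rho y)" "q < dim_col (rho x * rho y)"
  then have pq: "p < r * d" "q < r * d" by (simp_all add: rho_def)
  define k a i b where "k = p div d" and "a = p mod d" and "i = q div d" and "b = q mod d"
  have ka: "k < r" "a < d" "p = k * d + a" and ib: "i < r" "b < d" "q = i * d + b"
    using block_index_split[OF pq(1)] block_index_split[OF pq(2)]
    by (simp_all add: k_def a_def i_def b_def)
  have entry: "(blk x k j * blk y j i) $$ (a, b) =
      (\<Sum>c<d. blk x k j $$ (a, c) * blk y j i $$ (c, b))" for j
    using ka ib by (intro mult_mat_entry) (auto simp: blk_carrier)
  have "(rho x * rho y) $$ (p, q) = (\<Sum>l<r * d. rho x $$ (p, l) * rho y $$ (l, q))"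
    by (rule mult_mat_entry[OF rho_carrier rho_carrier pq])
  also have "\<dots> = (\<Sum>j<r. \<Sum>c<d. blk x k j $$ (a, c) * blk y j i $$ (c, b))"
    unfolding sum_blocks ka ib by (intro sum.cong refl) (simp add: rho_entry ka ib)
  also have "\<dots> = (\<Sum>j<r. (blk x k j * blk y j i) $$ (a, b))" by (simp add: entry)
  also have "\<dots> = blk (x * y) k i $$ (a, b)"
  \<comment> \<open>Only the index of the image of \<open>\<chi> i\<close> under \<open>y\<close>
    can contribute; if \<open>y\<close> is undefined at \<open>\<chi> i\<close>, every term vanishes
    and so does the block of \<open>x y\<close>.\<close>
  proof (cases "\<exists>j<r. moves y (\<chi> i) (\<chi> j)")
    case True
    then obtain j where j: "j < r" "moves y (\<chi> i) (\<chi> j)" by blast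
    have "(\<Sum>j'<r. (blk x k j' * blk y j' i) $$ (a, b)) =
        (\<Sum>j'\<in>{j}. (blk x k j' * blk y j' i) $$ (a, b))"
    proof (rule sum.mono_neutral_right)
      show "\<forall>j'\<in>{..<r} - {j}. (blk x k j' * blk y j' i) $$ (a, b) = 0"
      proof
        fix j' assume j': "j' \<in> {..<r} - {j}"
        then have "\<not> moves y (\<chi> i) (\<chi> j')" using j chi_inj moves_fun by blast
        then have "blk y j' i = 0\<^sub>m d d" using j' ib by (intro blk_zero) auto
        then show "(blk x k j' * blk y j' i) $$ (a, b) = 0"
          using blk_carrier[of x k j'] ka ib by simp
      qed
    qed (use j in auto)
    then show ?thesis using blk_mult[OF ib(1) j(1) ka(1) j(2)] by simp
  next
    case False
    then have "\<not> moves (x * y) (\<chi> i) (\<chi> k)"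
      unfolding moves_mult using orbit_closed[OF ib(1)] by blast
    then have "blk (x * y) k i = 0\<^sub>m d d" using ib ka by (simp add: blk_zero)
    moreover have "(blk x k j * blk y j i) $$ (a, b) = 0" if "j < r" for j
    proof -
      have "blk y j i = 0\<^sub>m d d" using False that ib by (intro blk_zero) auto
      then show ?thesis using blk_carrier[of x k j] ka ib by simp
    qed
    ultimately show ?thesis using ka ib by simp
  qed
  also have "\<dots> = rho (x * y) $$ (p, q)" using ka ib by (simp add: rho_entry)
  finally show "rho (x * y) $$ (p, q) = (rho x * rho y) $$ (p, q)" ..
qed (simp_all add: rho_def)

lemma bl_rho_sum:
  assumes v: "v \<in> carrier_vec (r * d)" and j: "j < r" and a: "a < d"
  shows "bl j (rho x *\<^sub>v v) $ a = (\<Sum>i<r. (blk x j i *\<^sub>v bl i v) $ a)"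
proof -
  have "bl j (rho x *\<^sub>v v) $ a = (\<Sum>q<r * d. rho x $$ (j * d + a, q) * v $ q)"
    using mult_mat_vec_entry[OF rho_carrier v block_index[OF j a]] a by (simp add: bl_def)
  also have "\<dots> = (\<Sum>i<r. \<Sum>b<d. blk x j i $$ (a, b) * bl i v $ b)"
    unfolding sum_blocks by (intro sum.cong refl) (simp add: rho_entry j a bl_def)
  also have "\<dots> = (\<Sum>i<r. (blk x j i *\<^sub>v bl i v) $ a)"
    using mult_mat_vec_entry[OF blk_carrier bl_carrier a] by simp
  finally show ?thesis .
qed

text \<open>The action is injective, so \<open>i\<close> is the only source of block
  \<open>j\<close>.\<close>

lemma bl_rho:
  assumes v: "v \<in> carrier_vec (r * d)" and ij: "i < r" "j < r" "moves x (\<chi> i) (\<chi> j)"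
  shows "bl j (rho x *\<^sub>v v) = blk x j i *\<^sub>v bl i v"
proof (rule eq_vecI)
  fix a assume "a < dim_vec (blk x j i *\<^sub>v bl i v)"
  then have a: "a < d" using blk_carrier[of x j i] by simp
  have "(\<Sum>i'<r. (blk x j i' *\<^sub>v bl i' v) $ a) = (\<Sum>i'\<in>{i}. (blk x j i' *\<^sub>v bl i' v) $ a)"
  proof (rule sum.mono_neutral_right)
    show "\<forall>i'\<in>{..<r} - {i}. (blk x j i' *\<^sub>v bl i' v) $ a = 0"
    proof
      fix i' assume i': "i' \<in> {..<r} - {i}"
      then have "\<not> moves x (\<chi> i') (\<chi> j)" using ij chi_inj moves_inj by blast
      then have "blk x j i' = 0\<^sub>m d d" using i' ij by (intro blk_zero) auto
      then show "(blk x j i' *\<^sub>v bl i' v) $ a = 0" using a by (simp add: zero_mult_vec)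
    qed
  qed (use ij in auto)
  then show "bl j (rho x *\<^sub>v v) $ a = (blk x j i *\<^sub>v bl i v) $ a"
    using bl_rho_sum[OF v ij(2) a] by simp
qed (use blk_carrier[of x j i] in \<open>simp add: bl_def\<close>)

text \<open>Covers two situations at once: no point of the orbit is moved to
  \<open>\<chi> j\<close>, or the block of \<open>v\<close> at the source vanishes.\<close>

lemma bl_rho_zero:
  assumes v: "v \<in> carrier_vec (r * d)" and j: "j < r"
    and no: "\<And>i. i < r \<Longrightarrow> moves x (\<chi> i) (\<chi> j) \<Longrightarrow> bl i v = 0\<^sub>v d"
  shows "bl j (rho x *\<^sub>v v) = 0\<^sub>v d"
proof (rule eq_vecI)
  fix a assume "a < dim_vec (0\<^sub>v d :: 'k vec)"
  then have a: "a < d" by simp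
  have "(blk x j i *\<^sub>v bl i v) $ a = 0" if i: "i < r" for i
  proof (cases "moves x (\<chi> i) (\<chi> j)")
    case True
    then show ?thesis using no[OF i] a mult_mat_vec_zero[OF blk_carrier] by simp
  next
    case False
    then have "blk x j i = 0\<^sub>m d d" using i j by (intro blk_zero)
    then show ?thesis using a by (simp add: zero_mult_vec)
  qed
  then show "bl j (rho x *\<^sub>v v) $ a = 0\<^sub>v d $ a" using bl_rho_sum[OF v j a] a by simp
qed (simp add: bl_def)

lemma vec_eqI_bl:
  assumes v: "v \<in> carrier_vec (r * d)" and w: "w \<in> carrier_vec (r * d)"
    and eq: "\<And>j. j < r \<Longrightarrow> bl j v = bl j w"
  shows "v = w"
proof (rule eq_vecI)
  fix p assume "p < dim_vec w"
  then have "p < r * d" using w by simp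
  note p = block_index_split[OF this]
  have "bl (p div d) v $ (p mod d) = bl (p div d) w $ (p mod d)" using eq[OF p(1)] by simp
  then show "v $ p = w $ p" using p by (simp add: bl_def)
qed (use v w in simp)

lemma bl_emb:
  assumes "i < r" "j < r" "u \<in> carrier_vec d"
  shows "bl j (emb i u) = (if j = i then u else 0\<^sub>v d)"
  using assms block_index by (intro eq_vecI) (auto simp: bl_def emb_def)

lemma bl_add:
  assumes "i < r" "v \<in> carrier_vec (r * d)" "w \<in> carrier_vec (r * d)"
  shows "bl i (v + w) = bl i v + bl i w"
  using assms block_index by (intro eq_vecI) (auto simp: bl_def)

lemma bl_smult:
  assumes "i < r" "v \<in> carrier_vec (r * d)" shows "bl i (c \<cdot>\<^sub>v v) = c \<cdot>\<^sub>v bl i v"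
  using assms block_index by (intro eq_vecI) (auto simp: bl_def)

lemma bl_zero: "i < r \<Longrightarrow> bl i (0\<^sub>v (r * d)) = 0\<^sub>v d"
  using block_index by (intro eq_vecI) (auto simp: bl_def)

lemma rho_emb:
  assumes ij: "i < r" "j < r" "moves x (\<chi> i) (\<chi> j)" and u: "u \<in> carrier_vec d"
  shows "rho x *\<^sub>v emb i u = emb j (blk x j i *\<^sub>v u)"
proof (rule vec_eqI_bl)
  have bu: "blk x j i *\<^sub>v u \<in> carrier_vec d" using blk_carrier u by (rule mult_mat_vec_carrier)
  fix k assume k: "k < r"
  show "bl k (rho x *\<^sub>v emb i u) = bl k (emb j (blk x j i *\<^sub>v u))"
  proof (cases "k = j")
    case True
    then show ?thesis using bl_rho[OF emb_carrier ij] bl_emb ij u bu by simp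
  next
    case False
    have "bl k (rho x *\<^sub>v emb i u) = 0\<^sub>v d"
    proof (rule bl_rho_zero[OF emb_carrier k])
      fix l assume l: "l < r" "moves x (\<chi> l) (\<chi> k)"
      have "l \<noteq> i"
      proof
        assume "l = i"
        then have "\<chi> k = \<chi> j" using moves_fun[OF l(2)] ij(3) by simp
        then show False using chi_inj k ij(2) False by blast
      qed
      then show "bl l (emb i u) = 0\<^sub>v d" using l ij u by (simp add: bl_emb)
    qed
    then show ?thesis using False k ij bu by (simp add: bl_emb)
  qed
qed (rule mult_mat_vec_carrier[OF rho_carrier emb_carrier], rule emb_carrier)

text \<open>As \<open>t base\<close> is idempotent, the argument of \<open>F\<close> in this block
  lies below \<open>x\<close>; outside the stabilizer both sides are zero.\<close>

lemma blk_base: "blk x base base = F x"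
proof (cases "x \<in> stab \<phi>")
  case True
  have "(t base)\<^sup>\<star> * x * t base \<preceq> x"
    using nat_le_trans[OF nat_le_mult_idem nat_le_idem_mult] base(2) by simp
  moreover have "(t base)\<^sup>\<star> * x * t base \<in> stab \<phi>"
    using True unfolding stab_block_iff[OF base(1) base(1)] by (simp add: chi_base stab_iff_moves phi)
  ultimately show ?thesis unfolding blk_def by (rule F_le[rotated, symmetric])
next
  case False
  then show ?thesis
    using base(1) by (simp add: blk_zero chi_base stab_iff_moves phi F_out)
qed

lemma rho_separates:
  assumes "rho x = rho y" shows "F x = F y"
proof (rule eq_matI)
  fix a b assume "a < dim_row (F y)" "b < dim_col (F y)"
  then have "a < d" "b < d" using F_carrier[of y] by auto
  then show "F x $$ (a, b) = F y $$ (a, b)"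
    using rho_entry[of base base a b x] rho_entry[of base base a b y] base(1) assms by (simp add: blk_base)
qed (use F_carrier[of x] F_carrier[of y] in auto)

section \<open>Irreducibility of the induced representation\<close>

context
  fixes W :: "'k vec set"
  assumes W: "lin_subspace (r * d) W" and W_rho: "\<And>x w. w \<in> W \<Longrightarrow> rho x *\<^sub>v w \<in> W"
begin

lemma W_carrier: "w \<in> W \<Longrightarrow> w \<in> carrier_vec (r * d)"
  using W by (auto simp: lin_subspace_def)

text \<open>Idempotents act by deleting blocks, and they separate the characters of the orbit. So a
  nonzero vector of \<open>W\<close> with the fewest nonzero blocks has only one.\<close>

lemma single_block:
  assumes "W \<noteq> {0\<^sub>v (r * d)}"
  obtains i u where "i < r" "u \<in> carrier_vec d" "u \<noteq> 0\<^sub>v d" "emb i u \<in> W"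
proof -
  define supp where "supp w = {i \<in> {..<r}. bl i w \<noteq> 0\<^sub>v d}" for w
  have fin: "finite (supp w)" for w by (simp add: supp_def)
  have supp_ne: "w \<noteq> 0\<^sub>v (r * d) \<longleftrightarrow> supp w \<noteq> {}" if "w \<in> carrier_vec (r * d)" for w
  proof
    assume "w \<noteq> 0\<^sub>v (r * d)"
    moreover have "w = 0\<^sub>v (r * d)" if "supp w = {}"
      using that by (intro vec_eqI_bl[OF \<open>w \<in> carrier_vec (r * d)\<close>]) (auto simp: supp_def bl_zero)
    ultimately show "supp w \<noteq> {}" by blast
  qed (auto simp: supp_def bl_zero)
  have "0\<^sub>v (r * d) \<in> W" using W by (simp add: lin_subspace_def)
  then obtain w0 where "w0 \<in> W \<and> w0 \<noteq> 0\<^sub>v (r * d)" using assms by blast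
  from ex_has_least_nat[of "\<lambda>w. w \<in> W \<and> w \<noteq> 0\<^sub>v (r * d)", OF this, of "\<lambda>w. card (supp w)"]
  obtain w where w: "w \<in> W" "w \<noteq> 0\<^sub>v (r * d)"
    and least: "\<And>w'. w' \<in> W \<Longrightarrow> w' \<noteq> 0\<^sub>v (r * d) \<Longrightarrow> card (supp w) \<le> card (supp w')"
    by blast
  note wc = W_carrier[OF w(1)]
  obtain i where i: "i \<in> supp w" using supp_ne[OF wc] w by blast
  \<comment> \<open>An idempotent that is 1 at \<open>\<chi> p\<close> but not at
    \<open>\<chi> q\<close> would keep block \<open>p\<close> and delete block \<open>q\<close>,
    giving a nonzero vector of \<open>W\<close> with smaller support.\<close>
  have no_sep: "\<chi> q e = 1" if pq: "p \<in> supp w" "q \<in> supp w" and e: "e \<in> idems" "\<chi> p e = 1" for p q e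
  proof (rule ccontr)
    assume q: "\<chi> q e \<noteq> 1"
    have blw: "bl k (rho e *\<^sub>v w) = (if \<chi> k e = 1 then bl k w else 0\<^sub>v d)" if k: "k < r" for k
    proof (cases "\<chi> k e = 1")
      case True
      then have "moves e (\<chi> k) (\<chi> k)" using k e chi_characters by (simp add: moves_idem)
      then show ?thesis using bl_rho[OF wc k k] True k e by (simp add: blk_idem)
    next
      case False
      have "bl k (rho e *\<^sub>v w) = 0\<^sub>v d"
      proof (rule bl_rho_zero[OF wc k])
        fix l assume "l < r" "moves e (\<chi> l) (\<chi> k)"
        then have "\<chi> l e = 1" "\<chi> k = \<chi> l" using e by (simp_all add: moves_idem)
        then show "bl l w = 0\<^sub>v d" using False by simp
      qed
      then show ?thesis using False by simp
    qed
    have "supp (rho e *\<^sub>v w) \<subset> supp w"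
    proof
      show "supp (rho e *\<^sub>v w) \<subseteq> supp w" by (auto simp: supp_def blw split: if_splits)
      have "q \<notin> supp (rho e *\<^sub>v w)" using q by (simp add: supp_def blw)
      then show "supp (rho e *\<^sub>v w) \<noteq> supp w" using pq by blast
    qed
    then have "card (supp (rho e *\<^sub>v w)) < card (supp w)" by (rule psubset_card_mono[OF fin])
    moreover have "p \<in> supp (rho e *\<^sub>v w)" using pq e by (simp add: supp_def blw)
    then have "rho e *\<^sub>v w \<noteq> 0\<^sub>v (r * d)"
      using supp_ne[OF mult_mat_vec_carrier[OF rho_carrier wc]] by blast
    ultimately show False using least[OF W_rho[OF w(1)], of e] by simp
  qed
  \<comment> \<open>Applied in both directions, \<open>no_sep\<close> makes the two characters
    equal, and the enumeration has no repetitions.\<close>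
  have only: "j = i" if j: "j \<in> supp w" for j
  proof -
    have "\<chi> j = \<chi> i"
      using no_sep[OF i j] no_sep[OF j i] i j chi_characters
      by (intro character_eqI) (auto simp: supp_def)
    then show ?thesis using chi_inj i j by (auto simp: supp_def)
  qed
  have ir: "i < r" and bi: "bl i w \<noteq> 0\<^sub>v d" using i by (simp_all add: supp_def)
  have "w = emb i (bl i w)"
  proof (rule vec_eqI_bl[OF wc emb_carrier])
    fix j assume j: "j < r"
    have "bl j w = 0\<^sub>v d" if "j \<noteq> i" using only[of j] that j by (auto simp: supp_def)
    then show "bl j w = bl j (emb i (bl i w))" using bl_emb[OF ir j bl_carrier] by auto
  qed
  then have "emb i (bl i w) \<in> W" using w(1) by (rule subst[where P = "\<lambda>x. x \<in> W"])
  then show thesis by (rule that[OF ir bl_carrier bi])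
qed

text \<open>The vectors whose copy at \<open>base\<close> lies in \<open>W\<close> form an
  \<open>F\<close>-invariant subspace \<open>U\<close>. A single-block vector transported to
  \<open>base\<close> by \<open>(t i)\<^sup>\<star>\<close> shows that \<open>U\<close> is nonzero,
  hence everything, and \<open>t j\<close> transports it to block \<open>j\<close>.\<close>

lemma emb_W:
  assumes ne: "W \<noteq> {0\<^sub>v (r * d)}" and j: "j < r" and v: "v \<in> carrier_vec d"
  shows "emb j v \<in> W"
proof -
  \<comment> \<open>This is the argument of \<open>F\<close> in the \<open>(base, i)\<close> block
    of \<open>(t i)\<^sup>\<star>\<close>; being idempotent, it gives the identity block once it is
    known to be in the stabilizer.\<close>
  have idem_t: "(t base)\<^sup>\<star> * (t i)\<^sup>\<star> * t i \<in> idems" for i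
    using idems_mult[OF base(2) star_mult_in_idems(1)[of "t i"]] base(2) by (simp add: mult.assoc)
  define U where "U = {u \<in> carrier_vec d. emb base u \<in> W}"
  have add: "emb base (u + v) = emb base u + emb base v"
    if "u \<in> carrier_vec d" "v \<in> carrier_vec d" for u v
    using that base(1) by - (rule vec_eqI_bl, auto simp: bl_add bl_emb)
  have smult: "emb base (c \<cdot>\<^sub>v u) = c \<cdot>\<^sub>v emb base u" if "u \<in> carrier_vec d" for c u
    using that base(1) by - (rule vec_eqI_bl, auto simp: bl_smult bl_emb)
  have zero: "emb base (0\<^sub>v d) = 0\<^sub>v (r * d)"
    using base(1) by - (rule vec_eqI_bl, auto simp: bl_zero bl_emb)
  have "lin_subspace d U"
    using W unfolding U_def lin_subspace_def by (auto simp: add smult zero)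
  moreover have "F x *\<^sub>v u \<in> U" if x: "x \<in> stab \<phi>" and u: "u \<in> U" for x u
  proof -
    have "moves x (\<chi> base) (\<chi> base)" using x by (simp add: chi_base stab_iff_moves phi)
    then have "rho x *\<^sub>v emb base u = emb base (F x *\<^sub>v u)"
      using rho_emb[OF base(1) base(1)] u by (simp add: U_def blk_base)
    then have "emb base (F x *\<^sub>v u) \<in> W" using W_rho[of "emb base u" x] u by (simp add: U_def)
    then show ?thesis using F_carrier[of x] u by (simp add: U_def)
  qed
  ultimately have U: "U = {0\<^sub>v d} \<or> U = carrier_vec d" by (rule F_irreducible)
  obtain i u where i: "i < r" and u: "u \<in> carrier_vec d" "u \<noteq> 0\<^sub>v d" "emb i u \<in> W"
    using single_block[OF ne] .
  have mi: "moves ((t i)\<^sup>\<star>) (\<chi> i) (\<chi> base)" using moves_star[OF t_moves[OF i]] by (simp add: chi_base)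
  have "blk ((t i)\<^sup>\<star>) base i = 1\<^sub>m d"
    unfolding blk_def by (rule F_idem[OF idem_t stab_block_iff[OF i base(1), THEN iffD2, OF mi]])
  then have "rho ((t i)\<^sup>\<star>) *\<^sub>v emb i u = emb base u" using rho_emb[OF i base(1) mi u(1)] u(1) by simp
  then have "u \<in> U" using W_rho[OF u(3), of "(t i)\<^sup>\<star>"] u(1) by (simp add: U_def)
  then have "v \<in> U" using U u(2) v by blast
  have mj: "moves (t j) (\<chi> base) (\<chi> j)" using t_moves[OF j] by (simp add: chi_base)
  have "blk (t j) j base = 1\<^sub>m d"
    unfolding blk_def
    by (rule F_idem[OF idems_mult[OF star_mult_in_idems(1) base(2)]
          stab_block_iff[OF base(1) j, THEN iffD2, OF mj]])
  then have "rho (t j) *\<^sub>v emb base v = emb j v" using rho_emb[OF base(1) j mj v] v by simp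
  then show ?thesis using W_rho[of "emb base v" "t j"] \<open>v \<in> U\<close> by (simp add: U_def)
qed

text \<open>Every vector is the sum of its blocks. The induction is on a bound \<open>m\<close> such
  that all blocks from \<open>m\<close> on vanish, peeling off the last block that may be
  nonzero.\<close>

lemma W_all:
  assumes ne: "W \<noteq> {0\<^sub>v (r * d)}" shows "W = carrier_vec (r * d)"
proof -
  have "v \<in> W" if "v \<in> carrier_vec (r * d)" "m \<le> r" "\<And>j. m \<le> j \<Longrightarrow> j < r \<Longrightarrow> bl j v = 0\<^sub>v d" for v m
    using that
  proof (induction m arbitrary: v)
    case 0
    then have "v = 0\<^sub>v (r * d)" by - (rule vec_eqI_bl, auto simp: bl_zero)
    then show ?case using W by (simp add: lin_subspace_def)
  next
    case (Suc m)
    define v' where "v' = vec (r * d) (\<lambda>p. if p div d = m then 0 else v $ p)"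
    have v': "v' \<in> carrier_vec (r * d)" by (simp add: v'_def)
    have m: "m < r" using Suc.prems by simp
    have blv': "bl j v' = (if j = m then 0\<^sub>v d else bl j v)" if "j < r" for j
      using that block_index by (intro eq_vecI) (auto simp: bl_def v'_def)
    have "v' \<in> W"
      using Suc.prems m v' by (intro Suc.IH) (auto simp: blv' Suc_le_eq)
    moreover have "emb m (bl m v) \<in> W" by (rule emb_W[OF ne m bl_carrier])
    ultimately have "v' + emb m (bl m v) \<in> W" using W by (simp add: lin_subspace_def)
    moreover have "v = v' + emb m (bl m v)"
      using Suc.prems(1) v' m by - (rule vec_eqI_bl, auto simp: bl_add blv' bl_emb)
    ultimately show ?case by (rule ssubst[rotated])
  qed
  note key = this
  have "v \<in> W" if "v \<in> carrier_vec (r * d)" for v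
    by (rule key[OF that order_refl]) simp
  then show ?thesis using W_carrier by blast
qed

end

lemma rho_nonzero: "rho (t base) \<noteq> 0\<^sub>m (r * d) (r * d)"
proof
  assume *: "rho (t base) = 0\<^sub>m (r * d) (r * d)"
  have "t base \<in> stab \<phi>" using t_moves[OF base(1)] by (simp add: chi_base stab_iff_moves phi)
  then have "F (t base) = 1\<^sub>m d" by (rule F_idem[OF base(2)])
  then have "rho (t base) $$ (base * d + 0, base * d + 0) = 1"
    unfolding rho_entry[OF base(1) base(1) d_pos d_pos] blk_base using d_pos by simp
  then show False using block_index[OF base(1) d_pos] unfolding * by simp
qed

lemma rho_irreducible: "irreducible_fd_rep UNIV (*) (r * d) rho"
  unfolding irreducible_fd_rep_iff
proof (intro conjI)
  show "\<forall>W. lin_subspace (r * d) W \<and> (\<forall>s\<in>UNIV. \<forall>w\<in>W. rho s *\<^sub>v w \<in> W) \<longrightarrow>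
      W = {0\<^sub>v (r * d)} \<or> W = carrier_vec (r * d)"
  proof (intro allI impI)
    fix W assume W: "lin_subspace (r * d) W \<and> (\<forall>s\<in>UNIV. \<forall>w\<in>W. rho s *\<^sub>v w \<in> W)"
    have "W = carrier_vec (r * d)" if "W \<noteq> {0\<^sub>v (r * d)}"
      by (rule W_all[OF _ _ that]) (use W in simp_all)
    then show "W = {0\<^sub>v (r * d)} \<or> W = carrier_vec (r * d)" by blast
  qed
  show "\<exists>s\<in>UNIV. rho s \<noteq> 0\<^sub>m (r * d) (r * d)" using rho_nonzero by blast
  show "\<forall>s\<in>UNIV. \<forall>t\<in>UNIV. rho (s * t) = rho s * rho t" using rho_mult by blast
qed simp

end


section \<open>From representations of the maximal group image to representations of the
  semigroup\<close>

text \<open>The point that needs work is that idempotents act as the identity, which is derived from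
  irreducibility and one nonzero matrix.\<close>

lemma isotropy_stab_rep:
  assumes phi: "\<phi> \<in> characters"
    and irr: "irreducible_fd_rep (carrier (isotropy_group \<phi>)) (mult (isotropy_group \<phi>)) d \<psi>"
  shows "stab_rep \<phi> d (\<lambda>x. if x \<in> stab \<phi> then \<psi> (germ x \<phi>) else (0\<^sub>m d d :: 'k::field mat))"
proof -
  note irr' = irr[unfolded irreducible_fd_rep_iff carrier_isotropy[OF phi]]
  note irr_mult = conjunct1[OF conjunct2[OF irr']]
    and irr_nz = conjunct1[OF conjunct2[OF conjunct2[OF irr']]]
    and irr_inv = conjunct2[OF conjunct2[OF conjunct2[OF irr']]]
  have c: "\<psi> (germ x \<phi>) \<in> carrier_mat d d" if "x \<in> stab \<phi>" for x
    using conjunct1[OF irr'] that by blast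
  have m: "\<psi> (germ (x * y) \<phi>) = \<psi> (germ x \<phi>) * \<psi> (germ y \<phi>)"
    if "x \<in> stab \<phi>" "y \<in> stab \<phi>" for x y
  proof -
    have "\<psi> (mult (isotropy_group \<phi>) (germ x \<phi>) (germ y \<phi>)) = \<psi> (germ x \<phi>) * \<psi> (germ y \<phi>)"
      using irr_mult that by blast
    then show ?thesis by (simp only: mult_isotropy[OF phi that])
  qed
  have inv: "U = {0\<^sub>v d} \<or> U = carrier_vec d"
    if "lin_subspace d U" "\<And>x u. x \<in> stab \<phi> \<Longrightarrow> u \<in> U \<Longrightarrow> \<psi> (germ x \<phi>) *\<^sub>v u \<in> U" for U
    using irr_inv[rule_format, of U] that by blast
  obtain s where s: "s \<in> stab \<phi>" "\<psi> (germ s \<phi>) \<noteq> 0\<^sub>m d d" using irr_nz by blast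
  have one: "\<psi> (germ e \<phi>) = 1\<^sub>m d" if e: "e \<in> idems" "e \<in> stab \<phi>" for e
  proof -
    \<comment> \<open>The vectors fixed by the class of \<open>e\<close>. They include every
      \<open>\<psi> (germ x \<phi>) v\<close>, because \<open>e x\<close> and \<open>x\<close> have
      the same class, so they form a nonzero invariant subspace.\<close>
    let ?W = "{v \<in> carrier_vec d. \<psi> (germ e \<phi>) *\<^sub>v v = 1\<^sub>m d *\<^sub>v v}"
    have W: "lin_subspace d ?W" by (rule lin_subspace_equalizer[OF c[OF e(2)] one_carrier_mat])
    have range: "\<psi> (germ x \<phi>) *\<^sub>v v \<in> ?W" if "x \<in> stab \<phi>" "v \<in> carrier_vec d" for x v
    proof -
      have "germ (e * x) \<phi> = germ x \<phi>"
        by (rule germ_eq_of_le(2)[OF phi stab_mult[OF phi e(2) that(1)] nat_le_idem_mult[OF e(1)]])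
      then have "\<psi> (germ e \<phi>) * \<psi> (germ x \<phi>) = \<psi> (germ x \<phi>)" using m[OF e(2) that(1)] by simp
      then have "\<psi> (germ e \<phi>) *\<^sub>v (\<psi> (germ x \<phi>) *\<^sub>v v) = \<psi> (germ x \<phi>) *\<^sub>v v"
        using assoc_mult_mat_vec[OF c[OF e(2)] c[OF that(1)] that(2)] by simp
      moreover have "\<psi> (germ x \<phi>) *\<^sub>v v \<in> carrier_vec d" by (rule mult_mat_vec_carrier[OF c[OF that(1)] that(2)])
      ultimately show ?thesis by simp
    qed
    have "?W \<noteq> {0\<^sub>v d}"
    proof
      assume W0: "?W = {0\<^sub>v d}"
      have "\<psi> (germ s \<phi>) = 0\<^sub>m d d"
      proof (rule mat_eqI_vec[OF c[OF s(1)]])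
        fix v :: "'k vec" assume "v \<in> carrier_vec d"
        from range[OF s(1) this] have "\<psi> (germ s \<phi>) *\<^sub>v v \<in> {0\<^sub>v d}" unfolding W0 .
        then show "\<psi> (germ s \<phi>) *\<^sub>v v = 0\<^sub>m d d *\<^sub>v v"
          using \<open>v \<in> carrier_vec d\<close> by (simp add: zero_mult_vec)
      qed simp
      then show False using s(2) by simp
    qed
    moreover have "?W = {0\<^sub>v d} \<or> ?W = carrier_vec d"
    proof (rule inv[OF W])
      fix x u assume "x \<in> stab \<phi>" "u \<in> ?W"
      then show "\<psi> (germ x \<phi>) *\<^sub>v u \<in> ?W" by (intro range) blast+
    qed
    ultimately have all: "?W = carrier_vec d" by blast
    show ?thesis
    proof (rule mat_eqI_vec[OF c[OF e(2)] one_carrier_mat])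
      fix v :: "'k vec" assume "v \<in> carrier_vec d"
      then have "v \<in> ?W" unfolding all .
      then show "\<psi> (germ e \<phi>) *\<^sub>v v = 1\<^sub>m d *\<^sub>v v" by blast
    qed
  qed
  have "d \<noteq> 0"
  proof
    assume "d = 0"
    then have "\<psi> (germ s \<phi>) = 0\<^sub>m d d" using c[OF s(1)] by (intro eq_matI) auto
    then show False using s(2) by simp
  qed
  show ?thesis
  proof (unfold_locales, goal_cases)
    case 1 show ?case by (rule phi)
  next
    case 2 show ?case using \<open>d \<noteq> 0\<close> by simp
  next
    case (3 x) show ?case using c by simp
  next
    case (4 x y)
    from stab_mult[OF phi this] m[OF this] 4 show ?case by simp
  next
    case (5 x y)
    from germ_eq_of_le[OF phi this] 5(1) show ?case by simp
  next
    case (6 e) then show ?case using one by simp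
  next
    case (7 x) then show ?case by simp
  next
    case (8 U)
    show ?case
    proof (rule inv[OF 8(1)])
      fix x u assume "x \<in> stab \<phi>" "u \<in> U"
      then show "\<psi> (germ x \<phi>) *\<^sub>v u \<in> U" using 8(2)[of x u] by simp
    qed
  qed
qed

lemma (in stab_rep) induced_representation:
  assumes fin: "finite_index \<phi>"
  shows "\<exists>n (\<rho> :: 'a \<Rightarrow> 'k mat). irreducible_fd_rep UNIV (*) n \<rho> \<and> (\<forall>x y. \<rho> x = \<rho> y \<longrightarrow> F x = F y)"
proof -
  let ?O = "{\<chi>. \<exists>s. moves s \<phi> \<chi>}"
  have "?O = {act s \<phi> | s. \<phi> (s\<^sup>\<star> * s) = 1}" using phi by (auto simp: moves_def)
  then have "finite ?O" using fin by (simp add: finite_index_def)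
  then obtain h where h: "bij_betw h {..<card ?O} ?O"
    using ex_bij_betw_nat_finite[of ?O] by (auto simp: lessThan_atLeast0)
  have "\<exists>e\<in>idems. \<phi> e \<noteq> 0" using phi by (simp add: characters_def)
  then obtain e where "e \<in> idems" "\<phi> e \<noteq> 0" ..
  then have e: "e \<in> idems" "\<phi> e = 1" using character_values[OF phi, of e] by simp_all
  then have e': "moves e \<phi> \<phi>" by (simp add: moves_idem phi)
  then have "\<phi> \<in> h ` {..<card ?O}" using h by (auto simp: bij_betw_def)
  then obtain base where base: "base < card ?O" "h base = \<phi>" by auto
  \<comment> \<open>The orbit point \<open>\<phi>\<close> gets an idempotent \<open>e\<close> with
    \<open>\<phi> e = 1\<close> as its representative, as \<open>induced_rep\<close> demands; the
    other points get arbitrary ones.\<close>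
  define t where "t i = (if h i = \<phi> then e else (SOME s. moves s \<phi> (h i)))" for i
  have t: "moves (t i) \<phi> (h i)" if "i < card ?O" for i
  proof (cases "h i = \<phi>")
    case False
    have "\<exists>s. moves s \<phi> (h i)" using h that by (auto simp: bij_betw_def)
    then show ?thesis using False someI_ex[of "\<lambda>s. moves s \<phi> (h i)"] by (simp add: t_def)
  qed (simp add: t_def e')
  interpret induced_rep \<phi> d F "card ?O" h t base
  proof (unfold_locales, goal_cases)
    case (1 i) then show ?case by (rule t)
  next
    case (2 i j) then show ?case using h by (auto simp: bij_betw_def inj_on_def)
  next
    case (3 x \<chi>')
    then have "\<chi>' \<in> h ` {..<card ?O}" using h by (auto simp: bij_betw_def)
    then show ?case by auto
  next
    case 4 show ?case by (rule base(1))
  next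
    case 5 show ?case using base e by (simp add: t_def)
  qed
  show ?thesis by (intro exI conjI allI impI, rule rho_irreducible, rule rho_separates)
qed

text \<open>The trivial representation of an isotropy group induces one that detects membership in
  the stabilizer.\<close>

lemma trivial_irreducible:
  assumes "A \<noteq> {}"
  shows "irreducible_fd_rep A m 1 (\<lambda>_. 1\<^sub>m 1 :: 'k::field mat)"
  unfolding irreducible_fd_rep_iff
proof (intro conjI allI impI)
  show "\<exists>s\<in>A. (1\<^sub>m 1 :: 'k mat) \<noteq> 0\<^sub>m 1 1"
  proof -
    have "(1\<^sub>m 1 :: 'k mat) $$ (0, 0) \<noteq> 0\<^sub>m 1 1 $$ (0, 0)" by simp
    then have "(1\<^sub>m 1 :: 'k mat) \<noteq> 0\<^sub>m 1 1" by (rule contrapos_nn) (rule arg_cong)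
    then show ?thesis using assms by blast
  qed
  fix W :: "'k vec set"
  assume "lin_subspace 1 W \<and> (\<forall>s\<in>A. \<forall>w\<in>W. 1\<^sub>m 1 *\<^sub>v w \<in> W)"
  then have W: "W \<subseteq> carrier_vec 1" "0\<^sub>v 1 \<in> W" "\<And>c v. v \<in> W \<Longrightarrow> c \<cdot>\<^sub>v v \<in> W"
    by (auto simp: lin_subspace_def)
  have "v \<in> W" if w: "w \<in> W" "w \<noteq> 0\<^sub>v 1" and v: "v \<in> carrier_vec 1" for v w
  proof -
    have wc: "w \<in> carrier_vec 1" using W(1) w(1) by blast
    have "w $ 0 \<noteq> 0"
    proof
      assume "w $ 0 = 0"
      then have "w = 0\<^sub>v 1" using wc by (intro eq_vecI) auto
      with w(2) show False ..
    qed
    then have "v = (v $ 0 / w $ 0) \<cdot>\<^sub>v w" using wc v by (intro eq_vecI) auto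
    moreover have "(v $ 0 / w $ 0) \<cdot>\<^sub>v w \<in> W" by (rule W(3)[OF w(1)])
    ultimately show ?thesis by (rule ssubst)
  qed
  then show "W = {0\<^sub>v 1} \<or> W = carrier_vec 1" using W(1,2) by blast
qed simp_all


section \<open>Weights of an irreducible representation\<close>

locale irr_rep =
  fixes n :: nat and \<rho> :: "'a::inverse_semigroup \<Rightarrow> 'k::field mat"
  assumes irr: "irreducible_fd_rep UNIV (*) n \<rho>"
begin

lemma carrier [simp]: "\<rho> s \<in> carrier_mat n n"
  using irr by (simp add: irreducible_fd_rep_iff)

lemma mult: "\<rho> (s * t) = \<rho> s * \<rho> t"
  using irr by (simp add: irreducible_fd_rep_iff)

lemma mult_cong: "\<rho> s = \<rho> s' \<Longrightarrow> \<rho> t = \<rho> t' \<Longrightarrow> \<rho> (s * t) = \<rho> (s' * t')"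
  by (simp add: mult)

lemma mult_zero: "\<rho> s = 0\<^sub>m n n \<Longrightarrow> \<rho> (s * t) = 0\<^sub>m n n" "\<rho> t = 0\<^sub>m n n \<Longrightarrow> \<rho> (s * t) = 0\<^sub>m n n"
  using left_mult_zero_mat[OF carrier[of t], of n] right_mult_zero_mat[OF carrier[of s], of n]
  by (simp_all add: mult)

lemma mult_vec: "v \<in> carrier_vec n \<Longrightarrow> \<rho> s *\<^sub>v (\<rho> t *\<^sub>v v) = \<rho> (s * t) *\<^sub>v v"
  by (simp add: mult assoc_mult_mat_vec[OF carrier carrier])

text \<open>The star is determined by multiplication, so the congruence defined by
  \<open>\<rho>\<close> respects it. Exchanging \<open>s\<close> and \<open>t\<close> one occurrence
  at a time and commuting idempotents leads from \<open>s\<^sup>\<star>\<close> through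
  \<open>t\<^sup>\<star> t s\<^sup>\<star>\<close> to \<open>t\<^sup>\<star>\<close>.\<close>

lemma star_cong:
  assumes st: "\<rho> s = \<rho> t" shows "\<rho> (s\<^sup>\<star>) = \<rho> (t\<^sup>\<star>)"
proof -
  have "\<rho> (s\<^sup>\<star>) = \<rho> (s\<^sup>\<star> * (s * s\<^sup>\<star>))" by simp
  also have "\<dots> = \<rho> (s\<^sup>\<star> * (t * s\<^sup>\<star>))" by (intro mult_cong st refl)
  also have "\<dots> = \<rho> (s\<^sup>\<star> * (t * (t\<^sup>\<star> * (t * s\<^sup>\<star>))))" by simp
  also have "\<dots> = \<rho> (s\<^sup>\<star> * (s * (t\<^sup>\<star> * (t * s\<^sup>\<star>))))" by (intro mult_cong st[symmetric] refl)
  also have "s\<^sup>\<star> * (s * (t\<^sup>\<star> * (t * s\<^sup>\<star>))) = t\<^sup>\<star> * (t * s\<^sup>\<star>)"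
    using idems_left_commute[of "s\<^sup>\<star> * s" "t\<^sup>\<star> * t" "s\<^sup>\<star>"] by (simp add: mult.assoc)
  also have "\<rho> (t\<^sup>\<star> * (t * s\<^sup>\<star>)) = \<rho> (t\<^sup>\<star> * (s * s\<^sup>\<star>))" by (intro mult_cong st[symmetric] refl)
  also have "t\<^sup>\<star> * (s * s\<^sup>\<star>) = t\<^sup>\<star> * (s * (s\<^sup>\<star> * (t * t\<^sup>\<star>)))"
    using idems_commute[of "s * s\<^sup>\<star>" "t * t\<^sup>\<star>"] by (simp add: mult.assoc)
  also have "\<rho> \<dots> = \<rho> (t\<^sup>\<star> * (s * (s\<^sup>\<star> * (s * t\<^sup>\<star>))))" by (intro mult_cong st[symmetric] refl)
  also have "\<dots> = \<rho> (t\<^sup>\<star> * (s * t\<^sup>\<star>))" by simp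
  also have "\<dots> = \<rho> (t\<^sup>\<star> * (t * t\<^sup>\<star>))" by (intro mult_cong st refl)
  also have "\<dots> = \<rho> (t\<^sup>\<star>)" by simp
  finally show ?thesis .
qed

text \<open>The idempotents that map to primitive idempotents of the commutative semigroup \<open>\<rho>(E(S))\<close>;
  their ranges are the weight spaces.\<close>

definition prim :: "'a \<Rightarrow> bool" where
  "prim e \<longleftrightarrow> e \<in> idems \<and> \<rho> e \<noteq> 0\<^sub>m n n \<and> (\<forall>f\<in>idems. \<rho> (f * e) = \<rho> e \<or> \<rho> (f * e) = 0\<^sub>m n n)"

text \<open>Among the idempotents with nonzero image one of least rank is primitive: if
  \<open>f e\<close> acted neither as zero nor as \<open>e\<close>, its rank would be
  smaller.\<close>

lemma ex_prim: "\<exists>e. prim e"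
proof -
  obtain s where s: "\<rho> s \<noteq> 0\<^sub>m n n" using irr by (auto simp: irreducible_fd_rep_iff)
  have "\<rho> (s\<^sup>\<star> * s) \<noteq> 0\<^sub>m n n"
  proof
    assume "\<rho> (s\<^sup>\<star> * s) = 0\<^sub>m n n"
    then have "\<rho> (s * (s\<^sup>\<star> * s)) = 0\<^sub>m n n" by (rule mult_zero)
    then show False using s by simp
  qed
  then have ex: "s\<^sup>\<star> * s \<in> idems \<and> \<rho> (s\<^sup>\<star> * s) \<noteq> 0\<^sub>m n n" by simp
  obtain e where e: "e \<in> idems" "\<rho> e \<noteq> 0\<^sub>m n n"
    and least: "\<And>f. f \<in> idems \<and> \<rho> f \<noteq> 0\<^sub>m n n \<Longrightarrow> idem_rank n (\<rho> e) \<le> idem_rank n (\<rho> f)"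
    using ex_has_least_nat[of "\<lambda>e. e \<in> idems \<and> \<rho> e \<noteq> 0\<^sub>m n n", OF ex, of "\<lambda>e. idem_rank n (\<rho> e)"]
    by blast
  have sq: "\<rho> g * \<rho> g = \<rho> g" if "g \<in> idems" for g
    using that by (simp flip: mult)
  have "\<rho> (f * e) = \<rho> e" if f: "f \<in> idems" and nz: "\<rho> (f * e) \<noteq> 0\<^sub>m n n" for f
  proof (rule ccontr)
    assume neq: "\<rho> (f * e) \<noteq> \<rho> e"
    have fe: "f * e \<in> idems" using f e by simp
    have "idem_rank n (\<rho> (f * e)) < idem_rank n (\<rho> e)"
    proof (rule idem_rank_less[OF carrier sq[OF e(1)] carrier sq[OF fe] _ _ neq])
      show "\<rho> e * \<rho> (f * e) = \<rho> (f * e)"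
        using idems_left_commute[OF e(1) f, of e] e(1) by (simp flip: mult)
      show "\<rho> (f * e) * \<rho> e = \<rho> (f * e)" using e(1) by (simp add: mult.assoc flip: mult)
    qed
    then show False using least[of "f * e"] fe nz by simp
  qed
  then show ?thesis using e unfolding prim_def by blast
qed

lemma primD: "prim e \<Longrightarrow> e \<in> idems" "prim e \<Longrightarrow> \<rho> e \<noteq> 0\<^sub>m n n"
  by (simp_all add: prim_def)

lemma prim_cases: "prim e \<Longrightarrow> f \<in> idems \<Longrightarrow> \<rho> (f * e) = \<rho> e \<or> \<rho> (f * e) = 0\<^sub>m n n"
  by (simp add: prim_def)

text \<open>Distinct primitive images are orthogonal, since a nonzero product would equal both of
  them.\<close>

lemma finite_prim: "finite (\<rho> ` {e. prim e})"
proof (rule orthogonal_idempotents_finite[where n = n])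
  show "\<rho> ` {e. prim e} \<subseteq> carrier_mat n n" by auto
  show "0\<^sub>m n n \<notin> \<rho> ` {e. prim e}" using primD(2) by force
  fix p assume "p \<in> \<rho> ` {e. prim e}"
  then obtain e where e: "prim e" "p = \<rho> e" by blast
  then show "p * p = p" using primD(1) by (simp flip: mult)
  fix q assume "q \<in> \<rho> ` {e. prim e}" and neq: "p \<noteq> q"
  then obtain f where f: "prim f" "q = \<rho> f" by blast
  have "\<rho> (e * f) = \<rho> (f * e)" using idems_commute[of e f] primD(1) e(1) f(1) by simp
  then have "\<rho> (e * f) = 0\<^sub>m n n"
    using prim_cases[OF e(1) primD(1)[OF f(1)]] prim_cases[OF f(1) primD(1)[OF e(1)]] neq e(2) f(2)
    by auto
  then show "p * q = 0\<^sub>m n n" using e f by (simp add: mult)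
qed

text \<open>Conjugation pulls a test idempotent \<open>f\<close> back to
  \<open>s\<^sup>\<star> f s\<close>, to which primitivity of \<open>e\<close> applies. The image is
  nonzero because \<open>s e s\<^sup>\<star>\<close> fixes \<open>s e\<close> from the left.\<close>

lemma prim_conj:
  assumes e: "prim e" and s: "\<rho> (s * e) \<noteq> 0\<^sub>m n n" shows "prim (s * (e * s\<^sup>\<star>))"
proof -
  note ei = primD(1)[OF e]
  have se: "s * (e * s\<^sup>\<star>) * (s * e) = s * e"
    using idems_left_commute[of e "s\<^sup>\<star> * s" e] ei by (simp add: mult.assoc)
  have nz: "\<rho> (s * (e * s\<^sup>\<star>)) \<noteq> 0\<^sub>m n n"
    using mult_zero(1)[of "s * (e * s\<^sup>\<star>)" "s * e"] s by (auto simp: se)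
  have "\<rho> (f * (s * (e * s\<^sup>\<star>))) = \<rho> (s * (e * s\<^sup>\<star>)) \<or> \<rho> (f * (s * (e * s\<^sup>\<star>))) = 0\<^sub>m n n"
    if f: "f \<in> idems" for f
  proof -
    have eq: "f * (s * (e * s\<^sup>\<star>)) = s * (s\<^sup>\<star> * (f * s) * e * s\<^sup>\<star>)"
      using idems_left_commute[of f "s * s\<^sup>\<star>" "s * (e * s\<^sup>\<star>)"] f by (simp add: mult.assoc)
    from prim_cases[OF e conj_idem(2)[OF f]] show ?thesis
    proof
      assume "\<rho> (s\<^sup>\<star> * (f * s) * e) = \<rho> e"
      then show ?thesis unfolding eq by (intro disjI1 mult_cong refl)
    next
      assume "\<rho> (s\<^sup>\<star> * (f * s) * e) = 0\<^sub>m n n"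
      then show ?thesis unfolding eq by (rule disjI2[OF mult_zero(2)[OF mult_zero(1)]])
    qed
  qed
  then show ?thesis using nz conj_idem(1)[OF ei] unfolding prim_def by blast
qed

text \<open>This expresses that the weight spaces span. Each \<open>\<rho> s\<close> maps the weight
  space of \<open>e\<close> to zero or into that of \<open>s e s\<^sup>\<star>\<close>, so their
  union is invariant; the subspace where \<open>A\<close> and \<open>B\<close> agree contains
  it.\<close>

lemma prim_separate:
  assumes A: "A \<in> carrier_mat n n" and B: "B \<in> carrier_mat n n"
    and eq: "\<And>e. prim e \<Longrightarrow> A * \<rho> e = B * \<rho> e"
  shows "A = B"
proof (rule mat_eqI_vec[OF A B])
  let ?W = "{v \<in> carrier_vec n. A *\<^sub>v v = B *\<^sub>v v}"
  let ?X = "{\<rho> e *\<^sub>v v | e v. prim e \<and> v \<in> carrier_vec n} \<union> {0\<^sub>v n}"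
  have W: "lin_subspace n ?W" by (rule lin_subspace_equalizer[OF A B])
  obtain e where e: "prim e" using ex_prim by blast
  have "\<exists>v\<in>carrier_vec n. \<rho> e *\<^sub>v v \<noteq> 0\<^sub>v n"
  proof (rule ccontr)
    assume *: "\<not> ?thesis"
    have "\<rho> e = 0\<^sub>m n n" by (rule mat_eqI_vec[OF carrier zero_carrier_mat]) (use * in force)
    then show False using primD(2)[OF e] by simp
  qed
  then obtain v where v: "v \<in> carrier_vec n" "\<rho> e *\<^sub>v v \<noteq> 0\<^sub>v n" by blast
  have "?W = carrier_vec n"
  proof (rule irreducible_generates[OF irr _ _ _ v(2) W])
    show "?X \<subseteq> carrier_vec n" using mult_mat_vec_carrier[OF carrier] by auto
    show "\<rho> e *\<^sub>v v \<in> ?X" using e v(1) by blast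
    show "?X \<subseteq> ?W"
    proof
      fix x assume "x \<in> ?X"
      then consider "x = 0\<^sub>v n" | e v where "prim e" "v \<in> carrier_vec n" "x = \<rho> e *\<^sub>v v" by blast
      then show "x \<in> ?W"
      proof cases
        case 1 then show ?thesis using W unfolding lin_subspace_def by blast
      next
        case 2
        have "A *\<^sub>v x = (A * \<rho> e) *\<^sub>v v"
          unfolding 2(3) by (rule assoc_mult_mat_vec[OF A carrier 2(2), symmetric])
        also have "\<dots> = B *\<^sub>v x"
          unfolding eq[OF 2(1)] 2(3) by (rule assoc_mult_mat_vec[OF B carrier 2(2)])
        finally show ?thesis using mult_mat_vec_carrier[OF carrier 2(2)] 2(3) by blast
      qed
    qed
    fix s x assume "x \<in> ?X"
    then consider "x = 0\<^sub>v n" | e v where "prim e" "v \<in> carrier_vec n" "x = \<rho> e *\<^sub>v v" by blast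
    then show "\<rho> s *\<^sub>v x \<in> ?X"
    proof cases
      case 1 then show ?thesis using mult_mat_vec_zero[OF carrier] by simp
    next
      case 2
      show ?thesis
      proof (cases "\<rho> (s * e) = 0\<^sub>m n n")
        case True
        then have "\<rho> s *\<^sub>v x = 0\<^sub>v n" using 2 by (simp add: mult_vec zero_mult_vec)
        then show ?thesis by simp
      next
        case False
        have "s * (e * s\<^sup>\<star>) * (s * e) = s * e"
          using idems_left_commute[of e "s\<^sup>\<star> * s" e] primD(1)[OF 2(1)] by (simp add: mult.assoc)
        then have "\<rho> s *\<^sub>v x = \<rho> (s * (e * s\<^sup>\<star>)) *\<^sub>v (\<rho> (s * e) *\<^sub>v v)"
          using 2 by (simp add: mult_vec)
        moreover have "\<rho> (s * e) *\<^sub>v v \<in> carrier_vec n" by (rule mult_mat_vec_carrier[OF carrier 2(2)])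
        ultimately show ?thesis using prim_conj[OF 2(1) False] by blast
      qed
    qed
  qed
  then show "A *\<^sub>v v = B *\<^sub>v v" if "v \<in> carrier_vec n" for v using that by blast
qed

section \<open>The characters of the weight spaces\<close>

text \<open>The weight: it is 1 on the idempotents acting as the identity on
  \<open>\<rho>(e)V\<close>. For primitive \<open>e\<close> all others act there as zero. It depends
  on \<open>e\<close> only through \<open>\<rho> e\<close>, which is the source of finite
  index.\<close>

definition wt :: "'a \<Rightarrow> 'a \<Rightarrow> nat" where
  "wt e = (\<lambda>f\<in>idems. if \<rho> f * \<rho> e = \<rho> e then 1 else 0)"

lemma wt_eq_1: "f \<in> idems \<Longrightarrow> wt e f = 1 \<longleftrightarrow> \<rho> (f * e) = \<rho> e"
  by (simp add: wt_def mult)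

lemma wt_eq_0: "prim e \<Longrightarrow> f \<in> idems \<Longrightarrow> wt e f \<noteq> 1 \<longleftrightarrow> \<rho> (f * e) = 0\<^sub>m n n"
  using wt_eq_1[of f e] prim_cases[of e f] primD(2)[of e] by auto

lemma wt_cong: "\<rho> e = \<rho> f \<Longrightarrow> wt e = wt f"
  by (simp add: wt_def)

lemma wt_self: "e \<in> idems \<Longrightarrow> wt e e = 1"
  by (simp add: wt_eq_1 del: One_nat_def)

lemma wt_character:
  assumes e: "prim e" shows "wt e \<in> characters"
proof (rule characterI)
  fix f g :: 'a assume fg: "f \<in> idems" "g \<in> idems"
  have *: "\<rho> (f * (g * e)) = \<rho> (f * e)" if "\<rho> (g * e) = \<rho> e" by (intro mult_cong refl that)
  have "\<rho> (g * e) = \<rho> e" if h: "\<rho> (f * (g * e)) = \<rho> e"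
  proof (rule ccontr)
    assume "\<rho> (g * e) \<noteq> \<rho> e"
    then have "\<rho> (g * e) = 0\<^sub>m n n" using prim_cases[OF e fg(2)] by blast
    then have "\<rho> (f * (g * e)) = 0\<^sub>m n n" by (rule mult_zero)
    then show False using h primD(2)[OF e] by simp
  qed
  then show "wt e (f * g) = 1 \<longleftrightarrow> wt e f = 1 \<and> wt e g = 1"
    using fg * by (auto simp: wt_eq_1 mult.assoc simp del: One_nat_def)
next
  show "\<exists>f\<in>idems. wt e f = 1" using primD(1)[OF e] wt_self by blast
qed (auto simp: wt_def)

text \<open>The value at \<open>f\<close> of the moved character is that of \<open>wt e\<close> at
  \<open>s\<^sup>\<star> f s\<close>, and \<open>f s e s\<^sup>\<star> = s (s\<^sup>\<star> f s) e
  s\<^sup>\<star>\<close> transfers acting as identity or as zero from \<open>e\<close> to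
  \<open>s e s\<^sup>\<star>\<close>.\<close>

lemma moves_wt:
  assumes e: "prim e" and m: "moves s (wt e) \<chi>"
  shows "prim (s * (e * s\<^sup>\<star>))" "\<chi> = wt (s * (e * s\<^sup>\<star>))"
proof -
  have ss: "\<rho> (s\<^sup>\<star> * s * e) = \<rho> e" using m by (simp add: moves_def wt_eq_1 del: One_nat_def)
  have se: "\<rho> (s * e) \<noteq> 0\<^sub>m n n"
  proof
    assume "\<rho> (s * e) = 0\<^sub>m n n"
    then have "\<rho> (s\<^sup>\<star> * (s * e)) = 0\<^sub>m n n" by (rule mult_zero)
    then show False using ss primD(2)[OF e] by (simp add: mult.assoc)
  qed
  show p: "prim (s * (e * s\<^sup>\<star>))" by (rule prim_conj[OF e se])
  show "\<chi> = wt (s * (e * s\<^sup>\<star>))"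
  proof (rule character_eqI[OF moves_characters(2)[OF m] wt_character[OF p]])
    fix f :: 'a assume f: "f \<in> idems"
    have eq: "f * (s * (e * s\<^sup>\<star>)) = s * (s\<^sup>\<star> * (f * s) * e * s\<^sup>\<star>)"
      using idems_left_commute[of f "s * s\<^sup>\<star>" "s * (e * s\<^sup>\<star>)"] f by (simp add: mult.assoc)
    have chi: "\<chi> f = wt e (s\<^sup>\<star> * (f * s))" using m f by (auto simp: moves_def act_apply)
    show "\<chi> f = 1 \<longleftrightarrow> wt (s * (e * s\<^sup>\<star>)) f = 1"
    proof (cases "wt e (s\<^sup>\<star> * (f * s)) = 1")
      case True
      then have "\<rho> (s\<^sup>\<star> * (f * s) * e) = \<rho> e" using wt_eq_1[OF conj_idem(2)[OF f]] by blast
      then have "\<rho> (f * (s * (e * s\<^sup>\<star>))) = \<rho> (s * (e * s\<^sup>\<star>))" unfolding eq by (intro mult_cong refl)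
      then show ?thesis using True chi wt_eq_1[OF f] by simp
    next
      case False
      then have "\<rho> (s\<^sup>\<star> * (f * s) * e) = 0\<^sub>m n n" using wt_eq_0[OF e conj_idem(2)[OF f]] by blast
      then have "\<rho> (f * (s * (e * s\<^sup>\<star>))) = 0\<^sub>m n n"
        unfolding eq by (rule mult_zero(2)[OF mult_zero(1)])
      then show ?thesis using False chi wt_eq_0[OF p f] by simp
    qed
  qed
qed

text \<open>The orbit stays among the weights of primitive idempotents, and these are indexed by the
  finite set of their images.\<close>

lemma wt_finite_index:
  assumes e: "prim e" shows "finite_index (wt e)"
proof -
  have "finite ((\<lambda>p. \<lambda>f\<in>idems. if \<rho> f * p = p then 1 else 0 :: nat) ` \<rho> ` {e. prim e})"
    by (rule finite_imageI[OF finite_prim])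
  then have "finite (wt ` {e. prim e})" by (simp add: image_image wt_def)
  moreover have "{act s (wt e) | s. wt e (s\<^sup>\<star> * s) = 1} \<subseteq> wt ` {e. prim e}"
  proof
    fix \<chi> assume "\<chi> \<in> {act s (wt e) | s. wt e (s\<^sup>\<star> * s) = 1}"
    then obtain s where "moves s (wt e) \<chi>" using wt_character[OF e] by (auto simp: moves_def)
    from moves_wt[OF e this] show "\<chi> \<in> wt ` {e. prim e}" by blast
  qed
  ultimately show ?thesis unfolding finite_index_def by (rule rev_finite_subset)
qed

section \<open>Isotropy groups acting on weight spaces\<close>

text \<open>An element of the stabilizer maps the weight space into itself: the weight is 1 at
  \<open>e\<close>, hence also at \<open>s\<^sup>\<star> e s\<close>.\<close>

lemma stab_wt_range:
  assumes e: "prim e" and s: "s \<in> stab (wt e)" shows "\<rho> (s * e) = \<rho> (e * (s * e))"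
proof -
  note ei = primD(1)[OF e]
  have "act s (wt e) e = 1" using s ei by (simp add: stab_def wt_self)
  then have "\<rho> (s\<^sup>\<star> * (e * s) * e) = \<rho> e"
    using wt_eq_1[OF conj_idem(2)[OF ei]] by (simp add: act_apply ei)
  then have "\<rho> (s * (s\<^sup>\<star> * (e * s) * e)) = \<rho> (s * e)" by (intro mult_cong refl)
  moreover have "s * (s\<^sup>\<star> * (e * s) * e) = e * (s * e)"
    using idems_left_commute[of e "s * s\<^sup>\<star>" "s * e"] ei by (simp add: mult.assoc)
  ultimately show ?thesis by simp
qed

text \<open>For a common lower bound \<open>u\<close> in the stabilizer,
  \<open>u\<^sup>\<star> u\<close> is the identity on the weight space, and \<open>s\<close>,
  \<open>t\<close> both restrict to \<open>u\<close> there.\<close>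

lemma germ_wt_cong:
  assumes e: "prim e" and st: "s \<in> stab (wt e)" "t \<in> stab (wt e)"
    and eq: "germ s (wt e) = germ t (wt e)"
  shows "\<rho> (s * e) = \<rho> (t * e)"
proof -
  obtain u where u: "u \<in> stab (wt e)" "u \<preceq> s" "u \<preceq> t"
    using eq germ_eq_iff[OF wt_character[OF e] st] by blast
  have "\<rho> (u\<^sup>\<star> * u * e) = \<rho> e" using u(1) by (simp add: stab_def wt_eq_1 del: One_nat_def)
  then have 1: "\<rho> (w * (u\<^sup>\<star> * u * e)) = \<rho> (w * e)" for w by (intro mult_cong refl)
  have 2: "w * (u\<^sup>\<star> * u * e) = u * e" if "u \<preceq> w" for w
    using arg_cong[OF nat_le_star_mult[OF that, symmetric], of "\<lambda>z. z * e"]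
    by (simp add: mult.assoc)
  have "\<rho> (w * e) = \<rho> (u * e)" if "u \<preceq> w" for w using 1[of w] unfolding 2[OF that] ..
  from this[OF u(2)] this[OF u(3)] show ?thesis by simp
qed

text \<open>For \<open>g = e t e\<close>, the conjugate \<open>g e g\<^sup>\<star>\<close> is
  primitive and lies below \<open>e\<close>, so it has the same image as \<open>e\<close> and the
  same weight. Thus every nonzero compression of the semigroup to a weight space comes from the
  isotropy group.\<close>

lemma compress_in_stab:
  assumes e: "prim e" and nz: "\<rho> (e * (t * e)) \<noteq> 0\<^sub>m n n"
  shows "e * (t * e) \<in> stab (wt e)"
proof -
  note ei = primD(1)[OF e]
  define g where "g = e * (t * e)"
  have ge: "g * e = g" "e * g = g" using ei by (simp_all add: g_def mult.assoc)
  have "e * g\<^sup>\<star> = (g * e)\<^sup>\<star>" "g\<^sup>\<star> * e = (e * g)\<^sup>\<star>"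
    by (simp_all only: star_mult star_idem[OF ei])
  then have ge': "e * g\<^sup>\<star> = g\<^sup>\<star>" "g\<^sup>\<star> * e = g\<^sup>\<star>" unfolding ge by simp_all
  have "wt e (g\<^sup>\<star> * g) = 1"
  proof (rule ccontr)
    assume "wt e (g\<^sup>\<star> * g) \<noteq> 1"
    then have "\<rho> (g\<^sup>\<star> * g * e) = 0\<^sub>m n n" using wt_eq_0[OF e star_mult_in_idems(1)] by blast
    then have "\<rho> (g * (g\<^sup>\<star> * g * e)) = 0\<^sub>m n n" by (rule mult_zero)
    moreover have "g * (g\<^sup>\<star> * g * e) = g" by (simp add: mult.assoc ge)
    ultimately show False using nz by (simp flip: g_def)
  qed
  then have m: "moves g (wt e) (act g (wt e))"
    using wt_character[OF e] by (simp add: moves_def)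
  note p = moves_wt[OF e m]
  have "g * (e * g\<^sup>\<star>) * e = g * (e * g\<^sup>\<star>)" by (simp add: mult.assoc ge')
  then have "\<rho> (g * (e * g\<^sup>\<star>)) = \<rho> e"
    using prim_cases[OF e conj_idem(1)[OF ei, of g]] primD(2)[OF p(1)] by simp
  from wt_cong[OF this] have "act g (wt e) = wt e" using p(2) by simp
  then show ?thesis using m by (simp flip: g_def add: stab_iff_moves[OF wt_character[OF e]])
qed

text \<open>With \<open>\<rho> e = B C\<close> and \<open>C B = 1\<close>, the action of \<open>G\<^sub>\<phi>\<close> on the weight space \<open>\<rho> e V\<close> is
  \<open>[s, \<phi>] \<mapsto> C (\<rho> s) B\<close>.\<close>

lemma weight_space_rep:
  assumes e: "prim e"
  obtains d \<psi> B C where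
    "irreducible_fd_rep (carrier (isotropy_group (wt e))) (mult (isotropy_group (wt e))) d
       (\<psi> :: 'a set \<Rightarrow> 'k mat)"
    "B \<in> carrier_mat n d" "C \<in> carrier_mat d n" "B * C = \<rho> e"
    "\<And>s. s \<in> stab (wt e) \<Longrightarrow> \<psi> (germ s (wt e)) = C * \<rho> s * B"
proof -
  note ei = primD(1)[OF e] and ch = wt_character[OF e]
  define d where "d = idem_rank n (\<rho> e)"
  have "\<rho> e * \<rho> e = \<rho> e" using ei by (simp flip: mult)
  then obtain B C where "idem_split (\<rho> e) n d B C" and BC: "B * C = \<rho> e"
    using idem_rank_factorization[OF carrier] unfolding d_def by blast
  then have B: "B \<in> carrier_mat n d" and C: "C \<in> carrier_mat d n" and CB: "C * B = 1\<^sub>m d"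
    and eB: "\<rho> e * B = B" and Ce: "C * \<rho> e = C" by (auto simp: idem_split_def)
  have Bv: "B *\<^sub>v u \<in> carrier_vec n" if "u \<in> carrier_vec d" for u
    by (rule mult_mat_vec_carrier[OF B that])
  have Cv: "C *\<^sub>v v \<in> carrier_vec d" if "v \<in> carrier_vec n" for v
    by (rule mult_mat_vec_carrier[OF C that])
  have \<rho>v: "\<rho> s *\<^sub>v v \<in> carrier_vec n" if "v \<in> carrier_vec n" for s v
    by (rule mult_mat_vec_carrier[OF carrier that])
  have eBv: "\<rho> e *\<^sub>v (B *\<^sub>v u) = B *\<^sub>v u" if "u \<in> carrier_vec d" for u
    using assoc_mult_mat_vec[OF carrier B that, of e] eB by simp
  have Cev: "C *\<^sub>v (\<rho> e *\<^sub>v v) = C *\<^sub>v v" if "v \<in> carrier_vec n" for v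
    using assoc_mult_mat_vec[OF C carrier that, of e] Ce by simp
  have CBv: "C *\<^sub>v (B *\<^sub>v u) = u" if "u \<in> carrier_vec d" for u
    using assoc_mult_mat_vec[OF C B that] CB that by simp
  have BCv: "B *\<^sub>v (C *\<^sub>v v) = \<rho> e *\<^sub>v v" if "v \<in> carrier_vec n" for v
    using assoc_mult_mat_vec[OF B C that] BC by simp
  define \<Psi> where "\<Psi> s = C * \<rho> s * B" for s
  have \<Psi>: "\<Psi> s \<in> carrier_mat d d" for s
    unfolding \<Psi>_def by (rule mult_carrier_mat[OF mult_carrier_mat[OF C carrier] B])
  have \<Psi>v: "\<Psi> s *\<^sub>v u = C *\<^sub>v (\<rho> s *\<^sub>v (B *\<^sub>v u))" if "u \<in> carrier_vec d" for s u
    unfolding \<Psi>_def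
    using assoc_mult_mat_vec[OF mult_carrier_mat[OF C carrier] B that, of s]
      assoc_mult_mat_vec[OF C carrier Bv[OF that], of s] by simp
  have \<Psi>_e: "\<Psi> s *\<^sub>v u = C *\<^sub>v (\<rho> (s * e) *\<^sub>v (B *\<^sub>v u))" if "u \<in> carrier_vec d" for s u
    using \<Psi>v[OF that] mult_vec[OF Bv[OF that], of s e] eBv[OF that] by simp
  have \<Psi>_cong: "\<Psi> s = \<Psi> t" if "\<rho> (s * e) = \<rho> (t * e)" for s t
    by (rule mat_eqI_vec[OF \<Psi> \<Psi>]) (simp add: \<Psi>_e that)
  \<comment> \<open>The inner factor \<open>B C\<close> is \<open>\<rho> e\<close>, which is
    harmless because \<open>t\<close> keeps the weight space invariant.\<close>
  have \<Psi>_mult: "\<Psi> (s * t) = \<Psi> s * \<Psi> t" if t: "t \<in> stab (wt e)" for s t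
  proof (rule mat_eqI_vec[OF \<Psi> mult_carrier_mat[OF \<Psi> \<Psi>]])
    fix u :: "'k vec" assume u: "u \<in> carrier_vec d"
    let ?z = "\<rho> t *\<^sub>v (B *\<^sub>v u)"
    have z: "?z \<in> carrier_vec n" by (rule \<rho>v[OF Bv[OF u]])
    have "?z = \<rho> (t * e) *\<^sub>v (B *\<^sub>v u)" using mult_vec[OF Bv[OF u], of t e] eBv[OF u] by simp
    also have "\<dots> = \<rho> e *\<^sub>v (\<rho> (t * e) *\<^sub>v (B *\<^sub>v u))"
      using stab_wt_range[OF e t] mult_vec[OF Bv[OF u], of e "t * e"] by simp
    also have "\<rho> (t * e) *\<^sub>v (B *\<^sub>v u) = ?z" using mult_vec[OF Bv[OF u], of t e] eBv[OF u] by simp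
    finally have ez: "B *\<^sub>v (C *\<^sub>v ?z) = ?z" using BCv[OF z] by simp
    have "(\<Psi> s * \<Psi> t) *\<^sub>v u = \<Psi> s *\<^sub>v (C *\<^sub>v ?z)"
      using assoc_mult_mat_vec[OF \<Psi> \<Psi> u] \<Psi>v[OF u] by simp
    also have "\<dots> = C *\<^sub>v (\<rho> s *\<^sub>v ?z)" using \<Psi>v[OF Cv[OF z]] ez by simp
    also have "\<dots> = \<Psi> (s * t) *\<^sub>v u" using mult_vec[OF Bv[OF u]] \<Psi>v[OF u] by simp
    finally show "\<Psi> (s * t) *\<^sub>v u = (\<Psi> s * \<Psi> t) *\<^sub>v u" ..
  qed
  \<comment> \<open>Any representative may be chosen, since equal germs act alike on the weight
    space.\<close>
  define \<psi> where "\<psi> A = \<Psi> (SOME s. s \<in> A)" for A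
  have \<psi>: "\<psi> (germ s (wt e)) = \<Psi> s" if s: "s \<in> stab (wt e)" for s
  proof -
    have "s \<in> germ s (wt e)" using s by (simp add: in_germ_iff[OF ch])
    then have "(SOME t. t \<in> germ s (wt e)) \<in> germ s (wt e)" by (rule someI)
    then have "(SOME t. t \<in> germ s (wt e)) \<in> stab (wt e)"
      "germ s (wt e) = germ (SOME t. t \<in> germ s (wt e)) (wt e)"
      unfolding in_germ_iff[OF ch] by blast+
    from germ_wt_cong[OF e s this] show ?thesis unfolding \<psi>_def by (rule \<Psi>_cong[OF sym])
  qed
  have e_stab: "e \<in> stab (wt e)" by (simp add: stab_idem[OF ch ei] wt_self ei)
  have "irreducible_fd_rep (carrier (isotropy_group (wt e))) (mult (isotropy_group (wt e))) d \<psi>"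
    unfolding irreducible_fd_rep_iff carrier_isotropy[OF ch] ball_simps bex_simps
  proof (intro conjI ballI allI impI)
    fix s assume s: "s \<in> stab (wt e)"
    then show "\<psi> (germ s (wt e)) \<in> carrier_mat d d" by (simp add: \<psi> \<Psi>)
    fix t assume t: "t \<in> stab (wt e)"
    show "\<psi> (mult (isotropy_group (wt e)) (germ s (wt e)) (germ t (wt e))) =
        \<psi> (germ s (wt e)) * \<psi> (germ t (wt e))"
      unfolding mult_isotropy[OF ch s t] by (simp add: \<psi> s t stab_mult[OF ch] \<Psi>_mult)
  next
    have d: "d \<noteq> 0"
    proof
      assume "d = 0"
      then have "B * C = 0\<^sub>m n n" using B C by (intro eq_matI) (auto simp: scalar_prod_def)
      then show False using BC primD(2)[OF e] by simp
    qed
    have "\<psi> (germ e (wt e)) = 1\<^sub>m d" using \<psi>[OF e_stab] by (simp add: \<Psi>_def Ce CB)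
    moreover have "(1\<^sub>m d :: 'k mat) $$ (0, 0) \<noteq> 0\<^sub>m d d $$ (0, 0)" using d by simp
    ultimately have "\<psi> (germ e (wt e)) \<noteq> 0\<^sub>m d d" by auto
    then show "\<exists>s\<in>stab (wt e). \<psi> (germ s (wt e)) \<noteq> 0\<^sub>m d d" using e_stab by blast
  next
    fix U :: "'k vec set"
    assume "lin_subspace d U \<and> (\<forall>s\<in>stab (wt e). \<forall>u\<in>U. \<psi> (germ s (wt e)) *\<^sub>v u \<in> U)"
    then have U: "lin_subspace d U" and inv: "\<And>s u. s \<in> stab (wt e) \<Longrightarrow> u \<in> U \<Longrightarrow> \<Psi> s *\<^sub>v u \<in> U"
      using \<psi> by auto
    have Uc: "u \<in> carrier_vec d" if "u \<in> U" for u using U that by (auto simp: lin_subspace_def)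
    have U0: "0\<^sub>v d \<in> U" using U by (simp add: lin_subspace_def)
    show "U = {0\<^sub>v d} \<or> U = carrier_vec d"
    proof (cases "U = {0\<^sub>v d}")
      case False
      then obtain u0 where u0: "u0 \<in> U" "u0 \<noteq> 0\<^sub>v d" using U0 by blast
      \<comment> \<open>The invariant set generated by the image of \<open>U\<close>. To see that it
        lies in \<open>?W\<close>, replace \<open>t\<close> by \<open>e t e\<close>, which is in the
        stabilizer or acts as zero. Once \<open>?W\<close> is everything, \<open>C B = 1\<close>
        makes \<open>U\<close> everything.\<close>
      let ?X = "{\<rho> t *\<^sub>v (B *\<^sub>v u) | t u. u \<in> U}"
      let ?W = "{v \<in> carrier_vec n. C *\<^sub>v v \<in> U}"
      have "?W = carrier_vec n"
      proof (rule irreducible_generates[OF irr])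
        show "?X \<subseteq> carrier_vec n" using \<rho>v[OF Bv[OF Uc]] by blast
        show "\<rho> s *\<^sub>v x \<in> ?X" if "x \<in> ?X" for s x
        proof -
          from that obtain t u where tu: "u \<in> U" "x = \<rho> t *\<^sub>v (B *\<^sub>v u)" by blast
          then have "\<rho> s *\<^sub>v x = \<rho> (s * t) *\<^sub>v (B *\<^sub>v u)" using mult_vec[OF Bv[OF Uc]] by simp
          then show ?thesis using tu(1) by blast
        qed
        \<comment> \<open>The witness is \<open>t = e\<close>, which fixes the range of
          \<open>B\<close>.\<close>
        show "B *\<^sub>v u0 \<in> ?X" using eBv[OF Uc[OF u0(1)], symmetric] u0(1) by blast
        show "B *\<^sub>v u0 \<noteq> 0\<^sub>v n"
        proof
          assume "B *\<^sub>v u0 = 0\<^sub>v n"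
          then show False using CBv[OF Uc[OF u0(1)]] mult_mat_vec_zero[OF C] u0(2) by simp
        qed
        show "lin_subspace n ?W" by (rule lin_subspace_preimage[OF U C])
        show "?X \<subseteq> ?W"
        proof
          fix x assume "x \<in> ?X"
          then obtain t u where u: "u \<in> U" and x: "x = \<rho> t *\<^sub>v (B *\<^sub>v u)" by blast
          note uc = Uc[OF u]
          have xc: "x \<in> carrier_vec n" unfolding x by (rule \<rho>v[OF Bv[OF uc]])
          have "C *\<^sub>v x = C *\<^sub>v (\<rho> e *\<^sub>v (\<rho> t *\<^sub>v (\<rho> e *\<^sub>v (B *\<^sub>v u))))"
            using Cev[OF xc] x eBv[OF uc] by simp
          also have "\<dots> = C *\<^sub>v (\<rho> (e * (t * e)) *\<^sub>v (B *\<^sub>v u))"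
            using mult_vec[OF Bv[OF uc], of t e] mult_vec[OF Bv[OF uc], of e "t * e"] by simp
          also have "\<dots> \<in> U"
          proof (cases "\<rho> (e * (t * e)) = 0\<^sub>m n n")
            case True
            have "C *\<^sub>v (0\<^sub>m n n *\<^sub>v (B *\<^sub>v u)) = 0\<^sub>v d"
              using mult_mat_vec_zero[OF C] zero_mult_vec[OF Bv[OF uc]] by simp
            then show ?thesis using True U0 by simp
          next
            case False
            then show ?thesis using inv[OF compress_in_stab[OF e False] u] \<Psi>v[OF uc] by simp
          qed
          finally show "x \<in> ?W" using xc by blast
        qed
      qed
      then have CB_U: "C *\<^sub>v (B *\<^sub>v v) \<in> U" if "v \<in> carrier_vec d" for v using Bv[OF that] by blast
      have "v \<in> U" if "v \<in> carrier_vec d" for v using CB_U[OF that] unfolding CBv[OF that] .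
      then show ?thesis using Uc by blast
    qed simp
  qed
  then show thesis by (rule that[OF _ B C BC]) (simp add: \<psi> \<Psi>_def)
qed

end


section \<open>Separation of points\<close>

text \<open>Inseparability by irreducible representations. The argument \<open>K\<close> only
  carries the field, whose type does not appear in \<open>s\<close> and \<open>t\<close>.\<close>

definition rep_equal :: "'k::field itself \<Rightarrow> 'a::inverse_semigroup \<Rightarrow> 'a \<Rightarrow> bool" where
  "rep_equal K s t \<longleftrightarrow>
     (\<forall>n (\<rho> :: 'a \<Rightarrow> 'k mat). irreducible_fd_rep UNIV (*) n \<rho> \<longrightarrow> \<rho> s = \<rho> t)"

lemma rep_equal_mult:
  fixes K :: "'k::field itself" and s t :: "'a::inverse_semigroup"
  assumes "rep_equal K s s'" "rep_equal K t t'" shows "rep_equal K (s * t) (s' * t')"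
  unfolding rep_equal_def
proof (intro allI impI)
  fix n and \<rho> :: "'a \<Rightarrow> 'k mat" assume irr: "irreducible_fd_rep UNIV (*) n \<rho>"
  then interpret irr_rep n \<rho> by (rule irr_rep.intro)
  show "\<rho> (s * t) = \<rho> (s' * t')"
    using assms irr by (intro mult_cong) (simp_all add: rep_equal_def)
qed

lemma rep_equal_star:
  fixes K :: "'k::field itself" and s t :: "'a::inverse_semigroup"
  assumes "rep_equal K s t" shows "rep_equal K (s\<^sup>\<star>) (t\<^sup>\<star>)"
  unfolding rep_equal_def
proof (intro allI impI)
  fix n and \<rho> :: "'a \<Rightarrow> 'k mat" assume irr: "irreducible_fd_rep UNIV (*) n \<rho>"
  then interpret irr_rep n \<rho> by (rule irr_rep.intro)
  show "\<rho> (s\<^sup>\<star>) = \<rho> (t\<^sup>\<star>)"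
    using assms irr by (intro star_cong) (simp add: rep_equal_def)
qed

lemma rep_equal_refl: "rep_equal K s s"
  by (simp add: rep_equal_def)

text \<open>Evaluate the representation induced from \<open>\<psi>\<close>; its block at
  \<open>\<phi>\<close> is \<open>\<psi>\<close> extended by zero.\<close>

lemma rep_equal_character:
  assumes eq: "rep_equal TYPE('k::field) s t"
    and phi: "\<phi> \<in> characters" and fin: "finite_index \<phi>"
    and irr: "irreducible_fd_rep (carrier (isotropy_group \<phi>)) (mult (isotropy_group \<phi>)) d
      (\<psi> :: 'a::inverse_semigroup set \<Rightarrow> 'k mat)"
  shows "(if s \<in> stab \<phi> then \<psi> (germ s \<phi>) else 0\<^sub>m d d) =
     (if t \<in> stab \<phi> then \<psi> (germ t \<phi>) else 0\<^sub>m d d)"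
proof -
  interpret stab_rep \<phi> d "\<lambda>x. if x \<in> stab \<phi> then \<psi> (germ x \<phi>) else 0\<^sub>m d d"
    by (rule isotropy_stab_rep[OF phi irr])
  obtain n and \<rho> :: "'a \<Rightarrow> 'k mat" where "irreducible_fd_rep UNIV (*) n \<rho>"
    and sep: "\<forall>x y. \<rho> x = \<rho> y \<longrightarrow> (if x \<in> stab \<phi> then \<psi> (germ x \<phi>) else 0\<^sub>m d d) =
      (if y \<in> stab \<phi> then \<psi> (germ y \<phi>) else 0\<^sub>m d d)"
    using induced_representation[OF fin] by blast
  then have "\<rho> s = \<rho> t" using eq by (simp add: rep_equal_def)
  then show "(if s \<in> stab \<phi> then \<psi> (germ s \<phi>) else 0\<^sub>m d d) =
     (if t \<in> stab \<phi> then \<psi> (germ t \<phi>) else 0\<^sub>m d d)" using sep by blast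
qed

text \<open>For the trivial representation the extension by zero is the indicator of the
  stabilizer.\<close>

lemma rep_equal_stab:
  assumes eq: "rep_equal TYPE('k::field) s t"
    and phi: "\<phi> \<in> characters" and fin: "finite_index \<phi>"
  shows "s \<in> stab \<phi> \<longleftrightarrow> t \<in> stab \<phi>"
proof -
  have "\<exists>e\<in>idems. \<phi> e \<noteq> 0" using phi by (simp add: characters_def)
  then obtain e where "e \<in> idems" "\<phi> e \<noteq> 0" ..
  then have "e \<in> stab \<phi>" using character_values[OF phi, of e] by (simp add: stab_idem[OF phi])
  then have "carrier (isotropy_group \<phi>) \<noteq> {}" by (auto simp: carrier_isotropy[OF phi])
  from rep_equal_character[OF eq phi fin trivial_irreducible[OF this]]
  have "(if s \<in> stab \<phi> then 1\<^sub>m 1 else 0\<^sub>m 1 1 :: 'k mat) = (if t \<in> stab \<phi> then 1\<^sub>m 1 else 0\<^sub>m 1 1)" .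
  then have "(if s \<in> stab \<phi> then 1\<^sub>m 1 else 0\<^sub>m 1 1 :: 'k mat) $$ (0, 0) =
      (if t \<in> stab \<phi> then 1\<^sub>m 1 else 0\<^sub>m 1 1) $$ (0, 0)" by (rule arg_cong)
  then show ?thesis by (simp split: if_splits)
qed

theorem corollary6p29:
  shows "(\<forall>(s::'a::inverse_semigroup) t. s \<noteq> t \<longrightarrow>
            (\<exists>n (\<rho> :: 'a \<Rightarrow> 'k::field mat). irreducible_fd_rep UNIV (*) n \<rho> \<and> \<rho> s \<noteq> \<rho> t))
    \<longleftrightarrow>
      (\<forall>e\<in>(idems :: 'a set). \<forall>f\<in>idems. e \<noteq> f \<longrightarrow>
          (\<exists>\<phi>\<in>characters. finite_index \<phi> \<and> \<phi> e \<noteq> \<phi> f))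
      \<and>
      (\<forall>e\<in>(idems :: 'a set). \<forall>s. s \<noteq> e \<and> s\<^sup>\<star> * s = e \<and> e = s * s\<^sup>\<star> \<longrightarrow>
          (\<exists>\<phi>\<in>characters. finite_index \<phi> \<and> \<phi> e = 1 \<and>
             (act s \<phi> \<noteq> \<phi> \<or>
              act s \<phi> = \<phi> \<and>
                (\<exists>n (\<psi> :: 'a set \<Rightarrow> 'k mat).
                   irreducible_fd_rep (carrier (isotropy_group \<phi>)) (mult (isotropy_group \<phi>)) n \<psi>
                   \<and> \<psi> (germ s \<phi>) \<noteq> 1\<^sub>m n))))"
    (is "?sep \<longleftrightarrow> ?idem \<and> ?iso")
proof (intro iffI conjI)
  assume sep: ?sep
  show ?idem
  proof (intro ballI impI)
    fix e f :: 'a assume e: "e \<in> idems" and f: "f \<in> idems" and "e \<noteq> f"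
    then obtain n and \<rho> :: "'a \<Rightarrow> 'k mat"
      where irr: "irreducible_fd_rep UNIV (*) n \<rho>" and neq: "\<rho> e \<noteq> \<rho> f" using sep by blast
    interpret irr_rep n \<rho> by (rule irr_rep.intro[OF irr])
    obtain m where m: "prim m" "\<rho> (e * m) \<noteq> \<rho> (f * m)"
      using prim_separate[OF carrier carrier, of e f] neq unfolding mult by blast
    \<comment> \<open>Each of \<open>e\<close> and \<open>f\<close> acts on the weight space of
      \<open>m\<close> as identity or zero, so acting differently means different weights.\<close>
    have "wt m e \<noteq> wt m f"
      using m wt_eq_0[OF m(1) e] wt_eq_0[OF m(1) f] wt_eq_1[OF e, of m] wt_eq_1[OF f, of m] by metis
    then show "\<exists>\<phi>\<in>characters. finite_index \<phi> \<and> \<phi> e \<noteq> \<phi> f"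
      using wt_character[OF m(1)] wt_finite_index[OF m(1)] by blast
  qed
  show ?iso
  proof (intro ballI allI impI)
    fix e s :: 'a assume e: "e \<in> idems" and s: "s \<noteq> e \<and> s\<^sup>\<star> * s = e \<and> e = s * s\<^sup>\<star>"
    then obtain n and \<rho> :: "'a \<Rightarrow> 'k mat"
      where irr: "irreducible_fd_rep UNIV (*) n \<rho>" and neq: "\<rho> s \<noteq> \<rho> e" using sep by blast
    interpret irr_rep n \<rho> by (rule irr_rep.intro[OF irr])
    obtain m where m: "prim m" "\<rho> (s * m) \<noteq> \<rho> (e * m)"
      using prim_separate[OF carrier carrier, of s e] neq unfolding mult by blast
    note ch = wt_character[OF m(1)]
    have se: "s * e = s" using s star_inverse(1)[of s] by (simp add: mult.assoc)
    \<comment> \<open>Otherwise \<open>e\<close> kills the weight space of \<open>m\<close>, and so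
      does \<open>s = s e\<close>, so \<open>m\<close> would not separate them.\<close>
    have we: "wt m e = 1"
    proof (rule ccontr)
      assume "wt m e \<noteq> 1"
      then have 0: "\<rho> (e * m) = 0\<^sub>m n n" using wt_eq_0[OF m(1) e] by blast
      then have "\<rho> (s * (e * m)) = 0\<^sub>m n n" by (rule mult_zero)
      moreover have "s * (e * m) = s * m" using se by (simp flip: mult.assoc)
      ultimately show False using m(2) 0 by simp
    qed
    have "\<exists>d (\<psi> :: 'a set \<Rightarrow> 'k mat).
        irreducible_fd_rep (carrier (isotropy_group (wt m))) (mult (isotropy_group (wt m))) d \<psi>
        \<and> \<psi> (germ s (wt m)) \<noteq> 1\<^sub>m d" if act: "act s (wt m) = wt m"
    proof -
      obtain d and \<psi> :: "'a set \<Rightarrow> 'k mat" and B C where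
        \<psi>: "irreducible_fd_rep (carrier (isotropy_group (wt m))) (mult (isotropy_group (wt m))) d \<psi>"
        and B: "B \<in> carrier_mat n d" and C: "C \<in> carrier_mat d n" and BC: "B * C = \<rho> m"
        and germ: "\<And>s. s \<in> stab (wt m) \<Longrightarrow> \<psi> (germ s (wt m)) = C * \<rho> s * B"
        using weight_space_rep[OF m(1)] by blast
      have st: "s \<in> stab (wt m)" using act we s by (simp add: stab_def)
      have "\<psi> (germ s (wt m)) \<noteq> 1\<^sub>m d"
      proof
        assume "\<psi> (germ s (wt m)) = 1\<^sub>m d"
        then have 1: "C * \<rho> s * B = 1\<^sub>m d" using germ[OF st] by simp
        \<comment> \<open>Undoing the compression turns a trivial class of \<open>s\<close> into
          \<open>\<rho> (m s m) = \<rho> m\<close>. As \<open>s\<close> preserves the weight space,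
          \<open>s\<close> would act on it as the identity, just like \<open>e\<close>.\<close>
        have "\<rho> (m * (s * m)) = (B * C) * (\<rho> s * (B * C))" by (simp only: mult BC)
        also have "\<dots> = B * (C * (\<rho> s * B * C))"
          using assoc_mult_mat[OF B C mult_carrier_mat[OF carrier mult_carrier_mat[OF B C]]]
            assoc_mult_mat[OF carrier B C] by simp
        also have "C * (\<rho> s * B * C) = (C * \<rho> s * B) * C"
          using assoc_mult_mat[OF C mult_carrier_mat[OF carrier B] C] assoc_mult_mat[OF C carrier B]
          by simp
        also have "B * ((C * \<rho> s * B) * C) = B * C" using 1 C by simp
        also have "\<dots> = \<rho> m" by (rule BC)
        finally have "\<rho> (s * m) = \<rho> m" using stab_wt_range[OF m(1) st] by simp
        moreover have "\<rho> (e * m) = \<rho> m" using we wt_eq_1[OF e] by blast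
        ultimately show False using m(2) by simp
      qed
      with \<psi> show ?thesis by blast
    qed
    then show "\<exists>\<phi>\<in>characters. finite_index \<phi> \<and> \<phi> e = 1 \<and>
             (act s \<phi> \<noteq> \<phi> \<or>
              act s \<phi> = \<phi> \<and>
                (\<exists>n (\<psi> :: 'a set \<Rightarrow> 'k mat).
                   irreducible_fd_rep (carrier (isotropy_group \<phi>)) (mult (isotropy_group \<phi>)) n \<psi>
                   \<and> \<psi> (germ s \<phi>) \<noteq> 1\<^sub>m n))"
      using we wt_finite_index[OF m(1)] by (intro bexI[OF _ ch]) blast
  qed
next
  assume conds: "?idem \<and> ?iso"
  have idem: "e = f" if e: "e \<in> idems" and f: "f \<in> idems" and eq: "rep_equal TYPE('k) e f" for e f :: 'a
  proof (rule ccontr)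
    assume "e \<noteq> f"
    then obtain \<phi> where \<phi>: "\<phi> \<in> characters" "finite_index \<phi>" "\<phi> e \<noteq> \<phi> f"
      using conds e f by blast
    have "\<phi> e = 1 \<longleftrightarrow> \<phi> f = 1"
      using rep_equal_stab[OF eq \<phi>(1,2)] stab_idem[OF \<phi>(1)] e f by simp
    then show False using \<phi>(3) character_values[OF \<phi>(1) e] character_values[OF \<phi>(1) f] by auto
  qed
  have iso: "x = e" if e: "e \<in> idems" and x: "x\<^sup>\<star> * x = e" "e = x * x\<^sup>\<star>"
    and eq: "rep_equal TYPE('k) x e" for x e :: 'a
  proof (rule ccontr)
    assume "x \<noteq> e"
    then have "\<exists>\<phi>\<in>characters. finite_index \<phi> \<and> \<phi> e = 1 \<and> (act x \<phi> \<noteq> \<phi> \<or> act x \<phi> = \<phi> \<and>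
        (\<exists>n (\<psi> :: 'a set \<Rightarrow> 'k mat).
           irreducible_fd_rep (carrier (isotropy_group \<phi>)) (mult (isotropy_group \<phi>)) n \<psi>
           \<and> \<psi> (germ x \<phi>) \<noteq> 1\<^sub>m n))"
      using conjunct2[OF conds, rule_format, OF e, of x] x by simp
    then obtain \<phi> where \<phi>: "\<phi> \<in> characters" "finite_index \<phi>" "\<phi> e = 1"
      and alt: "act x \<phi> \<noteq> \<phi> \<or> (\<exists>n (\<psi> :: 'a set \<Rightarrow> 'k mat).
           irreducible_fd_rep (carrier (isotropy_group \<phi>)) (mult (isotropy_group \<phi>)) n \<psi>
           \<and> \<psi> (germ x \<phi>) \<noteq> 1\<^sub>m n)" by blast
    \<comment> \<open>\<open>\<phi> e = 1\<close> puts \<open>e\<close> in the stabilizer, and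
      inseparability puts \<open>x\<close> there too; this rules out alternative (a).\<close>
    have es: "e \<in> stab \<phi>" using \<phi> e by (simp add: stab_idem)
    then have xs: "x \<in> stab \<phi>" using rep_equal_stab[OF eq \<phi>(1,2)] by simp
    then have "act x \<phi> = \<phi>" by (simp add: stab_def)
    then obtain n and \<psi> :: "'a set \<Rightarrow> 'k mat" where
      \<psi>: "irreducible_fd_rep (carrier (isotropy_group \<phi>)) (mult (isotropy_group \<phi>)) n \<psi>"
        "\<psi> (germ x \<phi>) \<noteq> 1\<^sub>m n" using alt by blast
    interpret stab_rep \<phi> n "\<lambda>x. if x \<in> stab \<phi> then \<psi> (germ x \<phi>) else 0\<^sub>m n n"
      by (rule isotropy_stab_rep[OF \<phi>(1) \<psi>(1)])
    have "\<psi> (germ e \<phi>) = 1\<^sub>m n" using F_idem[OF e es] es by simp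
    then show False using rep_equal_character[OF eq \<phi>(1,2) \<psi>(1)] xs es \<psi>(2) by simp
  qed
  have "s = t" if eq: "rep_equal TYPE('k) s t" for s t :: 'a
  proof -
    note star = rep_equal_star[OF eq]
    have 1: "s\<^sup>\<star> * s = t\<^sup>\<star> * t" by (rule idem[OF _ _ rep_equal_mult[OF star eq]]) simp_all
    have 2: "s * s\<^sup>\<star> = t * t\<^sup>\<star>" by (rule idem[OF _ _ rep_equal_mult[OF eq star]]) simp_all
    have a: "(t\<^sup>\<star> * s)\<^sup>\<star> * (t\<^sup>\<star> * s) = s\<^sup>\<star> * (t * t\<^sup>\<star>) * s" by (simp add: star_mult mult.assoc)
    have b: "(t\<^sup>\<star> * s) * (t\<^sup>\<star> * s)\<^sup>\<star> = t\<^sup>\<star> * (s * s\<^sup>\<star>) * t" by (simp add: star_mult mult.assoc)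
    \<comment> \<open>Equal domain and range idempotents put \<open>t\<^sup>\<star> s\<close> in the
      maximal subgroup at \<open>t\<^sup>\<star> t\<close>, where condition (2) applies.\<close>
    have "t\<^sup>\<star> * s = t\<^sup>\<star> * t"
    proof (rule iso)
      show "t\<^sup>\<star> * t \<in> idems" by simp
      show "(t\<^sup>\<star> * s)\<^sup>\<star> * (t\<^sup>\<star> * s) = t\<^sup>\<star> * t"
        unfolding a 2[symmetric] 1[symmetric] by (simp add: mult.assoc)
      show "t\<^sup>\<star> * t = (t\<^sup>\<star> * s) * (t\<^sup>\<star> * s)\<^sup>\<star>" unfolding b 2 by (simp add: mult.assoc)
      show "rep_equal TYPE('k) (t\<^sup>\<star> * s) (t\<^sup>\<star> * t)" by (rule rep_equal_mult[OF rep_equal_refl eq])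
    qed
    then have "t * (t\<^sup>\<star> * s) = t" by simp
    moreover have "t * (t\<^sup>\<star> * s) = s * s\<^sup>\<star> * s" unfolding 2 by (simp add: mult.assoc)
    ultimately show ?thesis by (simp add: star_inverse)
  qed
  then show ?sep unfolding rep_equal_def by blast
qed

end
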